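(* Let $\mathbb{F}$ be an algebraically closed field of characteristic $p>2$. Let $(V,[\cdot,\cdot]_V,\alpha_V,B_V)$ be a restricted involutive quadratic Hom-Lie algebra over $\mathbb{F}$ with $p$-structure $[p]_V$, and let $\mathscr{D}\in\mathrm{Der}_{\alpha_V}(V)$ be a restricted derivation with the $p$-property, with data $\xi\in\mathbb{F}$, $a_0\in V$ ($\mathscr{D}^p=\xi\mathscr{D}\circ\alpha_V^{p-1}+\mathrm{ad}_V(a_0)\circ\alpha_V^{p-1}$, $\mathscr{D}(a_0)=0$), such that $B_V$ is $\mathscr{D}$-invariant. Let $x_0\in V$, $\lambda_0\in\mathbb{F}$ satisfy, with $\lambda=1$: $\lambda\mathscr{D}+\mathrm{ad}_V(x_0)=\mathscr{D}$, $\alpha_V(\mathscr{D}(x_0))=-\mathscr{D}(x_0)$, $\alpha_V\circ\mathscr{D}^2-\mathscr{D}^2\circ\alpha_V=\mathrm{ad}_V(\mathscr{D}(x_0))$. Let $L=\mathbb{F}e^*\oplus V\oplus\mathbb{F}e$ with skew-symmetric bracket $[x,y]=[x,y]_V+B_V(\mathscr{D}x,y)e$, $[e^*,x]=-[x,e^*]=\mathscr{D}(x)$ ($x,y\in V$), $[e^*,e^*]=0$, $e$ central, and twist $\alpha(x)=\alpha_V(x)+B_V(x_0,x)e$, $\alpha(e^* )=e^*+x_0+\lambda_0e$, $\alpha(e)=e$. Let $l,m\in\mathbb{F}$, let $u_0\in\mathfrak z(V)$ with $\mathscr{D}(u_0)=0$, and let $\mathscr{P}:V\to\mathbb{F}$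 satisfy $\mathscr{P}(\gamma u)=\gamma^p\mathscr{P}(u)$ and $\mathscr{P}(u+v)=\mathscr{P}(u)+\mathscr{P}(v)+\sum_{i=1}^{p-1}\eta_i^V(u,v)$ for all $u,v\in V$, $\gamma\in\mathbb{F}$. Then the map defined by $u^{[p]_L}=u^{[p]_V}+\mathscr{P}(u)e$ ($u\in V$), $(e^* )^{[p]_L}=a_0+le+\xi e^*$, $e^{[p]_L}=me+u_0$ (and extended to $L$ by the axioms) is a $p$-structure on $(L,[\cdot,\cdot],\alpha)$, extending $[p]_V$.
   Context: Hom-Lie algebra: $(\mathfrak g,[\cdot,\cdot],\alpha)$ with $[x,y]=-[y,x]$, $[\alpha(x),[y,z]]+[\alpha(y),[z,x]]+[\alpha(z),[x,y]]=0$, $\alpha([x,y])=[\alpha x,\alpha y]$; involutive: $\alpha^2=\mathrm{id}$; quadratic: symmetric nondegenerate bilinear $B$ with $B([x,y],z)=B(x,[y,z])$, $B(\alpha x,y)=B(x,\alpha y)$. $\mathfrak z(V)$ is the center. A $p$-structure on $\mathfrak g$ is a map $x\mapsto x^{[p]}$ with (R1) $\mathrm{ad}(x^{[p]})\circ\alpha^{p-1}=\mathrm{ad}(\alpha^{p-1}x)\circ\mathrm{ad}(\alpha^{p-2}x)\circ\cdots\circ\mathrm{ad}(x)$; (R2) $(kx)^{[p]}=k^px^{[p]}$; (R3) $(x+y)^{[p]}=x^{[p]}+y^{[p]}+\sum_{i=1}^{p-1}s_i(x,y)$, where $\mathrm{ad}(\alpha^{p-2}(kx+y))\circ\cdots\circ\mathrm{ad}(kx+y)(x)=\sum_{i=1}^{p-1}is_i(x,y)k^{i-1}$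 for all $k$; restricted = with a $p$-structure. $\mathrm{Der}_{\alpha_V}(V)$: linear $\mathscr{D}$ with $\mathscr{D}\alpha_V=\alpha_V\mathscr{D}$, $\mathscr{D}[x,y]_V=[\mathscr{D}x,\alpha_Vy]_V+[\alpha_Vx,\mathscr{D}y]_V$; restricted: $\mathscr{D}(x^{[p]_V})=\mathrm{ad}_V(\alpha_V^{p-1}x)\circ\cdots\circ\mathrm{ad}_V(\alpha_Vx)(\mathscr{D}x)$; $p$-property: there are $\xi\in\mathbb{F}$, $a_0\in V$ with $\mathscr{D}^p=\xi\mathscr{D}\circ\alpha_V^{p-1}+\mathrm{ad}_V(a_0)\circ\alpha_V^{p-1}$, $\mathscr{D}(a_0)=0$. $B_V$ is $\mathscr{D}$-invariant if $B_V(\mathscr{D}x,y)+B_V(x,\mathscr{D}y)=0$. The scalars $\eta_i^V(u,v)$ are defined by $B_V\big(\mathscr{D}(\alpha_V^{p-2}(ku+v)),\mathrm{ad}_V(\alpha_V^{p-3}(ku+v))\circ\cdots\circ\mathrm{ad}_V(ku+v)(u)\big)=\sum_{i=1}^{p-1}i\eta_i^V(u,v)k^{i-1}$ for all $k\in\mathbb{F}$. *)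

theory Defs
  imports "HOL-Computational_Algebra.Polynomial" "HOL-Library.Product_Plus"
begin

primrec adchain :: "('a \<Rightarrow> 'a \<Rightarrow> 'a) \<Rightarrow> ('a \<Rightarrow> 'a) \<Rightarrow> 'a \<Rightarrow> nat \<Rightarrow> 'a \<Rightarrow> 'a" where
  "adchain br al z 0 x = x"
| "adchain br al z (Suc n) x = br ((al ^^ n) z) (adchain br al z n x)"

definition hom_lie_alg ::
  "('k::field \<Rightarrow> 'a::ab_group_add \<Rightarrow> 'a) \<Rightarrow> ('a \<Rightarrow> 'a \<Rightarrow> 'a) \<Rightarrow> ('a \<Rightarrow> 'a) \<Rightarrow> bool" where
  "hom_lie_alg sc br al \<longleftrightarrow>
     vector_space sc \<and>
     (\<forall>x. Vector_Spaces.linear sc sc (br x)) \<and>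
     (\<forall>y. Vector_Spaces.linear sc sc (\<lambda>x. br x y)) \<and>
     Vector_Spaces.linear sc sc al \<and>
     (\<forall>x y. br x y = - br y x) \<and>
     (\<forall>x y z. br (al x) (br y z) + br (al y) (br z x) + br (al z) (br x y) = 0) \<and>
     (\<forall>x y. al (br x y) = br (al x) (al y))"

definition involutive :: "('a \<Rightarrow> 'a) \<Rightarrow> bool" where
  "involutive al \<longleftrightarrow> (\<forall>x. al (al x) = x)"

definition quadratic_form ::
  "('k::field \<Rightarrow> 'a::ab_group_add \<Rightarrow> 'a) \<Rightarrow> ('a \<Rightarrow> 'a \<Rightarrow> 'a) \<Rightarrow> ('a \<Rightarrow> 'a) \<Rightarrow> ('a \<Rightarrow> 'a \<Rightarrow> 'k) \<Rightarrow> bool" where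
  "quadratic_form sc br al B \<longleftrightarrow>
     (\<forall>x. Vector_Spaces.linear sc (*) (B x)) \<and>
     (\<forall>x y. B x y = B y x) \<and>
     (\<forall>x. (\<forall>y. B x y = 0) \<longrightarrow> x = 0) \<and>
     (\<forall>x y z. B (br x y) z = B x (br y z)) \<and>
     (\<forall>x y. B (al x) y = B x (al y))"

text \<open>p-structure: axioms (R1), (R2), (R3).  In (R3) the s_i are the (unique, as the
  field is infinite) elements with
  ad(al^(p-2)(kx+y)) o ... o ad(kx+y) (x) = sum_{i=1}^{p-1} i s_i k^(i-1) for all k.\<close>
definition p_structure ::
  "nat \<Rightarrow> ('k::field \<Rightarrow> 'a::ab_group_add \<Rightarrow> 'a) \<Rightarrow> ('a \<Rightarrow> 'a \<Rightarrow> 'a) \<Rightarrow> ('a \<Rightarrow> 'a) \<Rightarrow> ('a \<Rightarrow> 'a) \<Rightarrow> bool" where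
  "p_structure p sc br al f \<longleftrightarrow>
     (\<forall>x y. br (f x) ((al ^^ (p - 1)) y) = adchain br al x p y) \<and>
     (\<forall>k x. f (sc k x) = sc (k ^ p) (f x)) \<and>
     (\<forall>x y (s :: nat \<Rightarrow> 'a).
        (\<forall>k. adchain br al (sc k x + y) (p - 1) x = (\<Sum>i = 1..p - 1. sc (of_nat i * k ^ (i - 1)) (s i)))
        \<longrightarrow> f (x + y) = f x + f y + (\<Sum>i = 1..p - 1. s i))"

definition hom_derivation ::
  "('k::field \<Rightarrow> 'a::ab_group_add \<Rightarrow> 'a) \<Rightarrow> ('a \<Rightarrow> 'a \<Rightarrow> 'a) \<Rightarrow> ('a \<Rightarrow> 'a) \<Rightarrow> ('a \<Rightarrow> 'a) \<Rightarrow> bool" where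
  "hom_derivation sc br al D \<longleftrightarrow>
     Vector_Spaces.linear sc sc D \<and>
     (\<forall>x. D (al x) = al (D x)) \<and>
     (\<forall>x y. D (br x y) = br (D x) (al y) + br (al x) (D y))"

definition restricted_derivation ::
  "nat \<Rightarrow> ('a \<Rightarrow> 'a \<Rightarrow> 'a) \<Rightarrow> ('a \<Rightarrow> 'a) \<Rightarrow> ('a \<Rightarrow> 'a) \<Rightarrow> ('a \<Rightarrow> 'a) \<Rightarrow> bool" where
  "restricted_derivation p br al pV D \<longleftrightarrow>
     (\<forall>x. D (pV x) = adchain br al (al x) (p - 1) (D x))"

definition p_property ::
  "nat \<Rightarrow> ('k::field \<Rightarrow> 'a::ab_group_add \<Rightarrow> 'a) \<Rightarrow> ('a \<Rightarrow> 'a \<Rightarrow> 'a) \<Rightarrow> ('a \<Rightarrow> 'a) \<Rightarrow> ('a \<Rightarrow> 'a) \<Rightarrow> 'k \<Rightarrow> 'a \<Rightarrow> bool" where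
  "p_property p sc br al D \<xi> a0 \<longleftrightarrow>
     (\<forall>y. (D ^^ p) y = sc \<xi> (D ((al ^^ (p - 1)) y)) + br a0 ((al ^^ (p - 1)) y)) \<and> D a0 = 0"

text \<open>The extension L = F e* + V + F e, modelled as triples (a, x, b) = a e* + x + b e.\<close>
definition scaleL :: "('k::field \<Rightarrow> 'v \<Rightarrow> 'v) \<Rightarrow> 'k \<Rightarrow> 'k \<times> 'v \<times> 'k \<Rightarrow> 'k \<times> 'v \<times> 'k" where
  "scaleL sc c w = (c * fst w, sc c (fst (snd w)), c * snd (snd w))"

definition bracketL ::
  "('k::field \<Rightarrow> 'v::ab_group_add \<Rightarrow> 'v) \<Rightarrow> ('v \<Rightarrow> 'v \<Rightarrow> 'v) \<Rightarrow> ('v \<Rightarrow> 'v \<Rightarrow> 'k) \<Rightarrow> ('v \<Rightarrow> 'v)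
    \<Rightarrow> 'k \<times> 'v \<times> 'k \<Rightarrow> 'k \<times> 'v \<times> 'k \<Rightarrow> 'k \<times> 'v \<times> 'k" where
  "bracketL sc br B D w w' =
     (let a = fst w; x = fst (snd w); a' = fst w'; x' = fst (snd w') in
      (0, sc a (D x') - sc a' (D x) + br x x', B (D x) x'))"

definition alphaL ::
  "('k::field \<Rightarrow> 'v::ab_group_add \<Rightarrow> 'v) \<Rightarrow> ('v \<Rightarrow> 'v) \<Rightarrow> ('v \<Rightarrow> 'v \<Rightarrow> 'k) \<Rightarrow> 'v \<Rightarrow> 'k
    \<Rightarrow> 'k \<times> 'v \<times> 'k \<Rightarrow> 'k \<times> 'v \<times> 'k" where
  "alphaL sc al B x0 lam0 w =
     (let a = fst w; x = fst (snd w); b = snd (snd w) in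
      (a, sc a x0 + al x, a * lam0 + B x0 x + b))"

end

theory Submission
  imports Defs "HOL-Computational_Algebra.Primes"
begin

text \<open>
  The twist of \<open>L\<close> is invertible, so \<open>\<alpha>\<inverse>[\<cdot>,\<cdot>]\<close> is an ordinary Lie bracket, and the twisted chain
  \<open>ad(\<alpha>^(n-1) x) \<dots> ad(x)\<close> equals \<open>\<alpha>^n\<close> composed with the \<open>n\<close>-th power of the untwisted \<open>ad(x)\<close>.
  A Hom-\<open>p\<close>-structure is therefore \<open>\<alpha>^(p-1)\<close> applied to an ordinary \<open>p\<close>-structure.

  For a Lie algebra over an infinite field of characteristic \<open>p\<close>, let \<open>s(x,y)\<close> be the sum of the \<open>s_i(x,y)\<close>,
  i.e. the integral over \<open>k\<close> from 0 to 1 of \<open>ad(kx+y)^(p-1) x\<close>. The one-form \<open>ad(w)^(p-1) dw\<close> is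
  closed, and this yields the cocycle identities of \<open>s\<close> without recourse to the universal
  enveloping algebra: both sides are polynomials of degree below \<open>p\<close> along a line and have the same
  derivative. Together with \<open>ad(x+y)^p = ad(x)^p + ad(y)^p + ad(s(x,y))\<close> this reduces the axioms for
  \<open>f(a e* + v + b e) = a^p f(e*) + f(v) + b^p f(e) + \<alpha>^(p-1) s(a e*, v)\<close> to (R1) on \<open>e*\<close>, \<open>V\<close>
  and \<open>e\<close>, and (R3) on \<open>V\<close>.
\<close>

section \<open>Vector-valued polynomial functions\<close>

locale infinite_vector_space = vector_space scale
  for scale :: "'a::field \<Rightarrow> 'b::ab_group_add \<Rightarrow> 'b" (infixr "*s" 75) +
  assumes infinite_field: "infinite (UNIV :: 'a set)"
begin

text \<open>\<open>pder n f f'\<close>: \<open>f\<close> is a polynomial function of degree at most \<open>n\<close> with formal derivative \<open>f'\<close>.\<close>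
inductive pder :: "nat \<Rightarrow> ('a \<Rightarrow> 'b) \<Rightarrow> ('a \<Rightarrow> 'b) \<Rightarrow> bool" where
  const: "pder n (\<lambda>_. v) (\<lambda>_. 0)"
| add: "pder n f f' \<Longrightarrow> pder n g g' \<Longrightarrow> pder n (\<lambda>k. f k + g k) (\<lambda>k. f' k + g' k)"
| shift: "pder n f f' \<Longrightarrow> pder (Suc n) (\<lambda>k. k *s f k) (\<lambda>k. f k + k *s f' k)"

lemma pder_eqI:
  assumes "pder n f f'" "\<And>k. f k = g k" "\<And>k. f' k = g' k"
  shows "pder n g g'"
  using assms by (metis ext)

lemma pder_Suc: "pder n f f' \<Longrightarrow> pder (Suc n) f f'"
  by (induction rule: pder.induct) (auto intro: pder.intros)

lemma pder_mono: "pder n f f' \<Longrightarrow> n \<le> m \<Longrightarrow> pder m f f'"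
  by (induction m) (auto simp: le_Suc_eq intro: pder_Suc)

lemma pder_scale: "pder n f f' \<Longrightarrow> pder n (\<lambda>k. c *s f k) (\<lambda>k. c *s f' k)"
proof (induction rule: pder.induct)
  case (const n v)
  show ?case using pder.const[of n "c *s v"] by simp
next
  case (add n f f' g g')
  show ?case by (rule pder_eqI[OF pder.add[OF add.IH]]) (simp_all add: scale_right_distrib)
next
  case (shift n f f')
  show ?case
    by (rule pder_eqI[OF pder.shift[OF shift.IH]])
       (simp_all add: scale_right_distrib mult.commute)
qed

lemma pder_minus: "pder n f f' \<Longrightarrow> pder n (\<lambda>k. - f k) (\<lambda>k. - f' k)"
  using pder_scale[of n f f' "-1"] by simp

lemma pder_diff:
  "pder n f f' \<Longrightarrow> pder n g g' \<Longrightarrow> pder n (\<lambda>k. f k - g k) (\<lambda>k. f' k - g' k)"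
  using pder.add[OF _ pder_minus] by simp

lemma pder_sum:
  assumes "\<And>i. i \<in> A \<Longrightarrow> pder n (f i) (f' i)"
  shows "pder n (\<lambda>k. \<Sum>i\<in>A. f i k) (\<lambda>k. \<Sum>i\<in>A. f' i k)"
  using assms
  by (induction A rule: infinite_finite_induct)
     (auto intro: pder.add pder.const)

lemma pder_affine: "pder 1 (\<lambda>k. k *s x + y) (\<lambda>_. x)"
  using pder.add[OF pder.shift[OF pder.const[of 0 x]] pder.const[of "Suc 0" y]] by simp

lemma pder_monom: "pder i (\<lambda>k. (k ^ i) *s v) (\<lambda>k. (of_nat i * k ^ (i - 1)) *s v)"
proof (induction i)
  case 0
  then show ?case using pder.const[of 0 v] by simp
next
  case (Suc i)
  show ?case
  proof (rule pder_eqI[OF pder.shift[OF Suc.IH]])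
    fix k
    show "(k ^ i) *s v + k *s (of_nat i * k ^ (i - 1)) *s v = (of_nat (Suc i) * k ^ (Suc i - 1)) *s v"
      by (cases i) (simp_all add: algebra_simps flip: scale_left_distrib)
  qed (simp add: mult.commute)
qed

section \<open>Coefficients of polynomial functions and uniqueness of the derivative\<close>

lemma pder_coeffs:
  assumes "pder n f f'"
  shows "\<exists>c. (\<forall>k. f k = (\<Sum>i\<le>n. (k ^ i) *s c i)) \<and>
             (\<forall>k. f' k = (\<Sum>i\<le>n. (of_nat i * k ^ (i - 1)) *s c i))"
  using assms
proof (induction rule: pder.induct)
  case (const n v)
  show ?case
    by (rule exI[of _ "\<lambda>i. if i = 0 then v else 0"]) (simp add: if_distrib cong: if_cong)
next
  case (add n f f' g g')
  from add.IH obtain c d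
    where "\<forall>k. f k = (\<Sum>i\<le>n. (k ^ i) *s c i)"
      "\<forall>k. f' k = (\<Sum>i\<le>n. (of_nat i * k ^ (i - 1)) *s c i)"
      "\<forall>k. g k = (\<Sum>i\<le>n. (k ^ i) *s d i)"
      "\<forall>k. g' k = (\<Sum>i\<le>n. (of_nat i * k ^ (i - 1)) *s d i)" by blast
  then show ?case
    by (intro exI[of _ "\<lambda>i. c i + d i"]) (simp add: scale_right_distrib sum.distrib)
next
  case (shift n f f')
  from shift.IH obtain c where c: "\<And>k. f k = (\<Sum>i\<le>n. (k ^ i) *s c i)"
      "\<And>k. f' k = (\<Sum>i\<le>n. (of_nat i * k ^ (i - 1)) *s c i)" by blast
  have *: "(k ^ i) *s x + k *s (of_nat i * k ^ (i - 1)) *s x = (of_nat (Suc i) * k ^ i) *s x"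
    for i k x
    by (cases i) (simp_all add: algebra_simps flip: scale_left_distrib)
  \<comment> \<open>Multiplication by \<open>k\<close> moves every coefficient up one place and
    leaves 0 as constant term.\<close>
  show ?case
  proof (intro exI[of _ "\<lambda>i. case i of 0 \<Rightarrow> 0 | Suc j \<Rightarrow> c j"] conjI allI)
    fix k
    show "k *s f k = (\<Sum>i\<le>Suc n. (k ^ i) *s (case i of 0 \<Rightarrow> 0 | Suc j \<Rightarrow> c j))"
      by (subst sum.atMost_Suc_shift) (simp add: c scale_sum_right)
    show "f k + k *s f' k =
        (\<Sum>i\<le>Suc n. (of_nat i * k ^ (i - 1)) *s (case i of 0 \<Rightarrow> 0 | Suc j \<Rightarrow> c j))"
      by (subst sum.atMost_Suc_shift)
         (simp only: c scale_sum_right sum.distrib[symmetric] *, simp)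
  qed
qed

text \<open>A linear functional with value 1 on a nonzero \<open>c j\<close> would turn the identity
  into a nonzero scalar polynomial vanishing on an infinite field.\<close>

lemma coeffs_eq_0:
  assumes zero: "\<And>k. (\<Sum>i\<le>n. (k ^ i) *s c i) = 0" and "j \<le> n"
  shows "c j = 0"
proof (rule ccontr)
  assume nz: "c j \<noteq> 0"
  interpret pair: vector_space_pair scale "(*) :: 'a \<Rightarrow> 'a \<Rightarrow> 'a"
    by (intro vector_space_pair.intro vector_space_axioms) (unfold_locales, auto simp: algebra_simps)
  have "independent {c j}" using nz by (simp add: dependent_single)
  from pair.linear_independent_extend[OF this, of "\<lambda>_. 1"]
  obtain g where g: "Vector_Spaces.linear scale (*) g" "g (c j) = 1" by auto
  interpret g: Vector_Spaces.linear scale "(*)" g by fact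
  define q where "q = (\<Sum>i\<le>n. monom (g (c i)) i)"
  have "poly q k = 0" for k
  proof -
    have "poly q k = g (\<Sum>i\<le>n. (k ^ i) *s c i)"
      by (simp add: q_def poly_sum poly_monom g.sum g.scale mult.commute)
    then show ?thesis by (simp add: zero g.zero)
  qed
  then have "q = 0" using infinite_field poly_roots_finite[of q] by auto
  moreover have "coeff q j = g (c j)"
    using \<open>j \<le> n\<close> by (simp add: q_def coeff_sum)
  ultimately show False using g by simp
qed

lemma coeffs_eq:
  assumes "\<And>k. (\<Sum>i\<le>n. (k ^ i) *s c i) = (\<Sum>i\<le>n. (k ^ i) *s d i)" and "j \<le> n"
  shows "c j = d j"
  using coeffs_eq_0[where c="\<lambda>i. c i - d i" and n=n and j=j] assms
  by (simp add: scale_right_diff_distrib sum_subtractf)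

text \<open>An infinite field determines the coefficients of \<open>f\<close>, and the derivative is
  read off from them, whatever degree bounds are used.\<close>

lemma pder_unique:
  assumes f: "pder n f f'" and g: "pder m f g'"
  shows "f' k = g' k"
proof -
  have "pder (max n m) (\<lambda>k. f k - f k) (\<lambda>k. f' k - g' k)"
    by (intro pder_diff) (auto intro: pder_mono[OF f] pder_mono[OF g])
  from pder_coeffs[OF this] obtain c
    where c: "\<And>k. 0 = (\<Sum>i\<le>max n m. (k ^ i) *s c i)"
      "\<And>k. f' k - g' k = (\<Sum>i\<le>max n m. (of_nat i * k ^ (i - 1)) *s c i)" by auto
  have "c i = 0" if "i \<le> max n m" for i
    using coeffs_eq_0[OF c(1)[symmetric] that] .
  with c(2)[of k] show ?thesis by simp
qed

text \<open>Below degree \<open>CHAR('a)\<close> every positive exponent is invertible in the field,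
  so differentiation kills only the constant term.\<close>

lemma pder_zero_imp_const:
  assumes f: "pder n f (\<lambda>_. 0)" and n: "n < CHAR('a)"
  shows "f k = f 0"
proof -
  from pder_coeffs[OF f] obtain c
    where c: "\<And>k. f k = (\<Sum>i\<le>n. (k ^ i) *s c i)"
      "\<And>k. 0 = (\<Sum>i\<le>n. (of_nat i * k ^ (i - 1)) *s c i)" by auto
  have *: "c (Suc i) = 0" if "Suc i \<le> n" for i
  proof -
    from that obtain n' where n': "n = Suc n'" by (cases n) auto
    have "(\<Sum>i\<le>n'. (k ^ i) *s of_nat (Suc i) *s c (Suc i)) = 0" for k
      using c(2)[of k] unfolding n'
      by (subst (asm) sum.atMost_Suc_shift) (simp del: of_nat_Suc add: mult.commute)
    from coeffs_eq_0[OF this, of i] that n'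
    have "(of_nat (Suc i) :: 'a) = 0 \<or> c (Suc i) = 0" by (simp del: of_nat_Suc)
    moreover have "(of_nat (Suc i) :: 'a) \<noteq> 0"
      using that n by (auto simp del: of_nat_Suc simp: of_nat_eq_0_iff_char_dvd dest!: dvd_imp_le)
    ultimately show ?thesis by blast
  qed
  have "f k = c 0" for k
  proof -
    have "f k = (\<Sum>i\<le>n. if i = 0 then c 0 else 0)"
      unfolding c by (rule sum.cong) (auto simp: * gr0_conv_Suc)
    then show ?thesis by simp
  qed
  then show ?thesis by simp
qed

end

section \<open>The Jacobson cocycle of a modular Lie algebra\<close>

locale lie_algebra = infinite_vector_space scale
  for scale :: "'a::field \<Rightarrow> 'b::ab_group_add \<Rightarrow> 'b" (infixr "*s" 75) +
  fixes br :: "'b \<Rightarrow> 'b \<Rightarrow> 'b"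
  assumes br_add_left: "br (x + y) z = br x z + br y z"
    and br_add_right: "br x (y + z) = br x y + br x z"
    and br_scale_left: "br (c *s x) y = c *s br x y"
    and br_scale_right: "br x (c *s y) = c *s br x y"
    and br_self: "br x x = 0"
    and jacobi: "br x (br y z) = br (br x y) z + br y (br x z)"
begin

lemma br_0_left [simp]: "br 0 y = 0"
  using br_scale_left[of 0 0 y] by simp

lemma br_0_right [simp]: "br x 0 = 0"
  using br_scale_right[of x 0 0] by simp

lemma br_skew: "br x y = - br y x"
proof -
  have "br (x + y) (x + y) = 0" by (rule br_self)
  then have "br y x + br x y = 0" unfolding br_add_left br_add_right by (simp add: br_self)
  then show ?thesis by (metis add.commute eq_neg_iff_add_eq_0)
qed

lemma br_sum_right: "br x (sum f A) = (\<Sum>i\<in>A. br x (f i))"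
  by (induction A rule: infinite_finite_induct) (simp_all add: br_add_right)

abbreviation ad_pow :: "'b \<Rightarrow> nat \<Rightarrow> 'b \<Rightarrow> 'b" where
  "ad_pow x n \<equiv> br x ^^ n"

lemma ad_pow_0 [simp]: "ad_pow x n 0 = 0"
  by (induction n) auto

lemma ad_pow_add: "ad_pow x n (y + z) = ad_pow x n y + ad_pow x n z"
  by (induction n) (simp_all add: br_add_right)

lemma ad_pow_scale: "ad_pow x n (c *s y) = c *s ad_pow x n y"
  by (induction n) (simp_all add: br_scale_right)

lemma ad_pow_scale_left: "ad_pow (c *s x) n y = (c ^ n) *s ad_pow x n y"
  by (induction n) (simp_all add: br_scale_right br_scale_left)

lemma ad_pow_self: "n > 0 \<Longrightarrow> ad_pow x n x = 0"
  by (cases n) (simp_all add: br_self funpow_swap1)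

section \<open>Leibniz rules and coefficients of iterated adjoint maps\<close>

lemma pder_br_const: "pder m g g' \<Longrightarrow> pder m (\<lambda>k. br v (g k)) (\<lambda>k. br v (g' k))"
proof (induction rule: pder.induct)
  case (const n u)
  show ?case using pder.const[of n "br v u"] by simp
next
  case (add n f f' g g')
  show ?case by (rule pder_eqI[OF pder.add[OF add.IH]]) (simp_all add: br_add_right)
next
  case (shift n f f')
  show ?case
    by (rule pder_eqI[OF pder.shift[OF shift.IH]]) (simp_all add: br_add_right br_scale_right)
qed

lemma pder_br:
  assumes "pder n f f'" "pder m g g'"
  shows "pder (n + m) (\<lambda>k. br (f k) (g k)) (\<lambda>k. br (f' k) (g k) + br (f k) (g' k))"
  using assms
proof (induction rule: pder.induct)
  case (const n u)
  show ?case
    by (rule pder_eqI[OF pder_mono[OF pder_br_const[OF const, of u], of "n + m"]]) simp_all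
next
  case (add n f f' h h')
  show ?case
    by (rule pder_eqI[OF pder.add[OF add.IH(1)[OF add.prems] add.IH(2)[OF add.prems]]])
       (simp_all add: br_add_left algebra_simps)
next
  case (shift n f f')
  show ?case
    unfolding add_Suc
    by (rule pder_eqI[OF pder.shift[OF shift.IH[OF shift.prems]]])
       (simp_all add: br_add_left br_scale_left scale_right_distrib algebra_simps)
qed

text \<open>Leibniz rule for an iterated bracket: summand \<open>i\<close> differentiates the factor
  \<open>w\<close> that has \<open>i\<close> further factors outside it, the last term
  differentiates the argument.\<close>

lemma pder_ad_pow:
  assumes w: "pder a w w'" and u: "pder d u u'"
  shows "pder (n * a + d) (\<lambda>t. ad_pow (w t) n (u t))
     (\<lambda>t. (\<Sum>i<n. ad_pow (w t) i (br (w' t) (ad_pow (w t) (n - 1 - i) (u t)))) + ad_pow (w t) n (u' t))"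
proof (induction n)
  case 0
  then show ?case using u by simp
next
  case (Suc n)
  show ?case
  proof (rule pder_eqI[OF pder_mono[OF pder_br[OF w Suc.IH], of "Suc n * a + d"]])
    fix t
    let ?A = "\<lambda>i. ad_pow (w t) i (br (w' t) (ad_pow (w t) (n - i) (u t)))"
    have "(\<Sum>i<n. br (w t) (ad_pow (w t) i (br (w' t) (ad_pow (w t) (n - 1 - i) (u t))))) =
        (\<Sum>i<n. ?A (Suc i))"
      by (intro sum.cong) auto
    then have "br (w t) (\<Sum>i<n. ad_pow (w t) i (br (w' t) (ad_pow (w t) (n - 1 - i) (u t)))) =
        (\<Sum>i<n. ?A (Suc i))" by (simp add: br_sum_right)
    moreover have "(\<Sum>i<Suc n. ?A i) = ?A 0 + (\<Sum>i<n. ?A (Suc i))"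
      by (rule sum.lessThan_Suc_shift)
    ultimately show "br (w' t) (ad_pow (w t) n (u t)) + br (w t)
          ((\<Sum>i<n. ad_pow (w t) i (br (w' t) (ad_pow (w t) (n - 1 - i) (u t)))) + ad_pow (w t) n (u' t)) =
        (\<Sum>i<Suc n. ad_pow (w t) i (br (w' t) (ad_pow (w t) (Suc n - 1 - i) (u t)))) +
          ad_pow (w t) (Suc n) (u' t)"
      by (simp add: br_add_right algebra_simps)
  qed (simp_all add: algebra_simps)
qed

text \<open>\<open>br w\<close> is a derivation, so summand \<open>i\<close> expands with
  coefficients \<open>i choose c\<close>, and these add up over \<open>i\<close> to
  \<open>Suc n choose Suc c\<close>. The induction does both at once by Pascal's rule.\<close>

lemma sum_ad_pow_br:
  "(\<Sum>i\<le>n. ad_pow w i (br y (ad_pow w (n - i) x))) =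
   (\<Sum>c\<le>n. of_nat (Suc n choose Suc c) *s br (ad_pow w c y) (ad_pow w (n - c) x))"
proof (induction n)
  case 0
  then show ?case by simp
next
  case (Suc n)
  let ?T = "\<lambda>c. br (ad_pow w c y) (ad_pow w (Suc n - c) x)"
  have step: "br w (br (ad_pow w c y) (ad_pow w (n - c) x)) = ?T (Suc c) + ?T c" if "c \<le> n" for c
    using that by (subst jacobi) (simp add: Suc_diff_le)
  have "(\<Sum>i\<le>Suc n. ad_pow w i (br y (ad_pow w (Suc n - i) x))) =
      ?T 0 + br w (\<Sum>i\<le>n. ad_pow w i (br y (ad_pow w (n - i) x)))"
    by (subst sum.atMost_Suc_shift) (simp add: br_sum_right)
  also have "br w (\<Sum>i\<le>n. ad_pow w i (br y (ad_pow w (n - i) x))) =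
      (\<Sum>c\<le>n. of_nat (Suc n choose Suc c) *s (?T (Suc c) + ?T c))"
    unfolding Suc.IH br_sum_right br_scale_right by (intro sum.cong refl) (simp only: step atMost_iff)
  also have "\<dots> = (\<Sum>c\<le>n. of_nat (Suc n choose Suc c) *s ?T (Suc c)) +
      (\<Sum>c\<le>n. of_nat (Suc n choose Suc c) *s ?T c)"
    by (simp add: scale_right_distrib sum.distrib)
  also have "(\<Sum>c\<le>n. of_nat (Suc n choose Suc c) *s ?T c) =
      (\<Sum>c\<le>Suc n. of_nat (Suc n choose Suc c) *s ?T c)" by (simp add: binomial_eq_0)
  also have "?T 0 + ((\<Sum>c\<le>n. of_nat (Suc n choose Suc c) *s ?T (Suc c)) + \<dots>) =
      (\<Sum>c\<le>Suc n. of_nat (Suc n choose c) *s ?T c) + (\<Sum>c\<le>Suc n. of_nat (Suc n choose Suc c) *s ?T c)"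
    by (simp only: sum.atMost_Suc_shift[of _ n]) (simp add: add.assoc)
  also have "\<dots> = (\<Sum>c\<le>Suc n. of_nat (Suc (Suc n) choose Suc c) *s ?T c)"
    by (simp only: binomial_Suc_Suc[of "Suc n"] of_nat_add scale_left_distrib sum.distrib)
  finally show ?case .
qed

text \<open>\<open>adcoef x y z n j\<close> is the coefficient of \<open>k^j\<close> in \<open>ad(kx+y)^n z\<close>.\<close>
primrec adcoef :: "'b \<Rightarrow> 'b \<Rightarrow> 'b \<Rightarrow> nat \<Rightarrow> nat \<Rightarrow> 'b" where
  "adcoef x y z 0 j = (if j = 0 then z else 0)"
| "adcoef x y z (Suc n) j =
     br y (adcoef x y z n j) + (if j = 0 then 0 else br x (adcoef x y z n (j - 1)))"

lemma adcoef_gt: "n < j \<Longrightarrow> adcoef x y z n j = 0"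
  by (induction n arbitrary: j) auto

lemma adcoef_0: "adcoef x y z n 0 = ad_pow y n z"
  by (induction n) auto

lemma adcoef_top: "adcoef x y z n n = ad_pow x n z"
  by (induction n) (auto simp: adcoef_gt)

lemma adcoef_scale: "adcoef (c *s x) (c *s y) (d *s z) n j = (c ^ n * d) *s adcoef x y z n j"
  by (induction n arbitrary: j) (simp_all add: br_scale_left br_scale_right algebra_simps)

lemma ad_pow_expand: "ad_pow (k *s x + y) n z = (\<Sum>j\<le>n. (k ^ j) *s adcoef x y z n j)"
proof (induction n)
  case 0
  then show ?case by simp
next
  case (Suc n)
  let ?c = "adcoef x y z n"
  have "ad_pow (k *s x + y) (Suc n) z =
      (\<Sum>j\<le>n. (k ^ j) *s br y (?c j)) + (\<Sum>j\<le>n. (k ^ Suc j) *s br x (?c j))"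
    by (simp add: Suc.IH br_sum_right br_scale_right br_add_left br_scale_left scale_right_distrib
        sum.distrib mult.commute)
  also have "(\<Sum>j\<le>n. (k ^ j) *s br y (?c j)) = (\<Sum>j\<le>Suc n. (k ^ j) *s br y (?c j))"
    by (simp add: adcoef_gt)
  also have "(\<Sum>j\<le>n. (k ^ Suc j) *s br x (?c j)) =
      (\<Sum>j\<le>Suc n. (k ^ j) *s (if j = 0 then 0 else br x (?c (j - 1))))"
    by (subst sum.atMost_Suc_shift) simp
  finally show ?case by (simp only: sum.distrib[symmetric] scale_right_distrib[symmetric] adcoef.simps)
qed

text \<open>Coefficient \<open>j\<close> contains \<open>j\<close> factors \<open>w t\<close>,
  whence the degree. Existence of a derivative is enough here; \<open>jac_derivative\<close>
  computes the combination that matters.\<close>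

lemma pder_adcoef_left:
  assumes w: "pder 1 w w'" and u: "pder d u u'"
  shows "\<exists>c'. pder (d + j) (\<lambda>t. adcoef (w t) z (u t) n j) c'"
proof (induction n arbitrary: j)
  case 0
  show ?case using pder_mono[OF u, of "d + j"] pder.const[of "d + j" 0] by (cases "j = 0") auto
next
  case (Suc n)
  obtain c' where c: "pder (d + j) (\<lambda>t. br z (adcoef (w t) z (u t) n j)) c'"
    using Suc.IH[of j] pder_br_const by blast
  show ?case
  proof (cases j)
    case 0
    with c show ?thesis by auto
  next
    case (Suc i)
    obtain e where e: "pder (d + i) (\<lambda>t. adcoef (w t) z (u t) n i) e" using Suc.IH by blast
    from pder.add[OF c pder_mono[OF pder_br[OF w e], of "d + j"]] Suc show ?thesis by auto
  qed
qed

text \<open>Coefficient \<open>j\<close> contains \<open>n - j\<close> factors \<open>z t\<close>.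
  Truncated subtraction is harmless, since the coefficient is 0 for \<open>j > n\<close>.\<close>

lemma pder_adcoef_right:
  assumes z: "pder 1 z z'"
  shows "\<exists>c'. pder (n - j) (\<lambda>t. adcoef x (z t) u n j) c'"
proof (induction n arbitrary: j)
  case 0
  show ?case using pder.const[of "0 - j"] by (cases "j = 0") auto
next
  case (Suc n)
  have 1: "\<exists>c'. pder (Suc n - j) (\<lambda>t. br (z t) (adcoef x (z t) u n j)) c'"
  proof (cases "j \<le> n")
    case True
    obtain e where "pder (n - j) (\<lambda>t. adcoef x (z t) u n j) e" using Suc.IH by blast
    from pder_br[OF z this] True show ?thesis by (auto simp: Suc_diff_le)
  next
    case False
    then show ?thesis using pder.const[of _ 0] by (auto simp: adcoef_gt)
  qed
  show ?case
  proof (cases j)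
    case 0
    with 1 show ?thesis by simp
  next
    case (Suc i)
    obtain e where "pder (n - i) (\<lambda>t. adcoef x (z t) u n i) e" using Suc.IH by blast
    from pder_br_const[OF this] 1 Suc pder.add show ?thesis by fastforce
  qed
qed

end

lemma sum_split_ends:
  "sum g {..Suc (Suc n)} = (g 0 + (\<Sum>j\<le>n. g (Suc j))) + g (Suc (Suc n))"
  by (subst sum.atMost_Suc, subst sum.atMost_Suc_shift) (rule refl)

section \<open>Characteristic \<open>p\<close>: binomial coefficients, closedness and the
  cocycle\<close>

locale modular_lie_algebra = lie_algebra scale br
  for scale :: "'a::field \<Rightarrow> 'b::ab_group_add \<Rightarrow> 'b" (infixr "*s" 75) and br +
  fixes p :: nat
  assumes char: "CHAR('a) = p" and p_gt_2: "p > 2"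
begin

lemma p_eq: "p = Suc (Suc (p - 2))" "p - 1 = Suc (p - 2)"
  using p_gt_2 by auto

lemma prime_p: "prime p"
  using prime_CHAR_semidom[where 'a='a] char p_gt_2 by simp

lemma odd_p: "odd p"
  using prime_p p_gt_2 by (simp add: prime_odd_nat)

lemma of_nat_neq_0: "0 < i \<Longrightarrow> i < p \<Longrightarrow> (of_nat i :: 'a) \<noteq> 0"
  using char by (auto simp: of_nat_eq_0_iff_char_dvd dest: dvd_imp_le)

lemma of_nat_choose_p: "0 < i \<Longrightarrow> i < p \<Longrightarrow> (of_nat (p choose i) :: 'a) = 0"
  using char prime_p by (simp add: of_nat_eq_0_iff_char_dvd dvd_choose_prime)

text \<open>Neighbouring entries of row \<open>p - 1\<close> of Pascal's triangle add up to an inner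
  entry of row \<open>p\<close>, which is 0 in the field.\<close>

lemma of_nat_choose_pred: "i < p \<Longrightarrow> (of_nat ((p - 1) choose i) :: 'a) = (- 1) ^ i"
proof (induction i)
  case 0
  then show ?case by simp
next
  case (Suc i)
  have "(of_nat (p choose Suc i) :: 'a) = of_nat ((p - 1) choose i) + of_nat ((p - 1) choose Suc i)"
    using binomial_Suc_Suc[of "p - 1" i] p_gt_2 by (simp flip: of_nat_add)
  then have "0 = (- 1) ^ i + (of_nat ((p - 1) choose Suc i) :: 'a)"
    using Suc of_nat_choose_p[of "Suc i"] by simp
  then show ?case by (simp add: eq_neg_iff_add_eq_0 add.commute)
qed

text \<open>The one-form \<open>ad(w)^(p-1) dw\<close> is closed: its derivative at \<open>w\<close> is a symmetric bilinear map.\<close>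
lemma sum_ad_pow_br_commute:
  "(\<Sum>i\<le>p - 2. ad_pow w i (br y (ad_pow w (p - 2 - i) x))) =
   (\<Sum>i\<le>p - 2. ad_pow w i (br x (ad_pow w (p - 2 - i) y)))"
proof -
  have expand: "(\<Sum>i\<le>p - 2. ad_pow w i (br y (ad_pow w (p - 2 - i) x))) =
      (\<Sum>c\<le>p - 2. ((- 1) ^ Suc c) *s br (ad_pow w c y) (ad_pow w (p - 2 - c) x))" for x y
    unfolding sum_ad_pow_br p_eq(2)[symmetric]
    using p_gt_2 by (intro sum.cong refl) (subst of_nat_choose_pred, auto)
  \<comment> \<open>Reversing the summation exchanges \<open>x\<close> and \<open>y\<close>. As
    \<open>p - 2\<close> is odd the sign changes, and skew symmetry of the bracket changes it
    back.\<close>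
  show ?thesis unfolding expand
  proof (rule sum.reindex_bij_witness[of _ "\<lambda>c. p - 2 - c" "\<lambda>c. p - 2 - c"])
    fix c assume c: "c \<in> {..p - 2}"
    then have "p = c + (p - 2 - c) + 2" using p_gt_2 by auto
    then have "odd (c + (p - 2 - c))" using odd_p by presburger
    then have sign: "((- 1) ^ Suc (p - 2 - c) :: 'a) = - ((- 1) ^ Suc c)"
      by (cases "even c") auto
    have inv: "p - 2 - (p - 2 - c) = c" using c by simp
    show "((- 1) ^ Suc (p - 2 - c)) *s br (ad_pow w (p - 2 - c) x) (ad_pow w (p - 2 - (p - 2 - c)) y) =
        ((- 1) ^ Suc c) *s br (ad_pow w c y) (ad_pow w (p - 2 - c) x)"
      unfolding sign inv br_skew[of "ad_pow w (p - 2 - c) x" "ad_pow w c y"]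
      by (simp only: scale_minus_left scale_minus_right minus_minus)
  qed auto
qed

text \<open>The coefficients in \<open>sum_ad_pow_br\<close> are now \<open>p choose Suc c\<close>,
  which vanish except for \<open>c = p - 1\<close>. The left side is the derivative of
  \<open>ad_pow w p v\<close> in direction \<open>x\<close>.\<close>

lemma sum_ad_pow_br_pred:
  "(\<Sum>i\<le>p - 1. ad_pow w i (br x (ad_pow w (p - 1 - i) v))) = br (ad_pow w (p - 1) x) v"
proof -
  have "(\<Sum>i\<le>p - 1. ad_pow w i (br x (ad_pow w (p - 1 - i) v))) =
      (\<Sum>c\<le>p - 1. if c = p - 1 then br (ad_pow w (p - 1) x) v else 0)"
    unfolding sum_ad_pow_br
  proof (intro sum.cong refl)
    fix c assume "c \<in> {..p - 1}"
    moreover have "Suc (p - 1) = p" using p_gt_2 by simp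
    ultimately show "of_nat (Suc (p - 1) choose Suc c) *s br (ad_pow w c x) (ad_pow w (p - 1 - c) v) =
        (if c = p - 1 then br (ad_pow w (p - 1) x) v else 0)"
      using of_nat_choose_p[of "Suc c"] by auto
  qed
  then show ?thesis by simp
qed

text \<open>The sum of the \<open>s_i(x,y)\<close> of axiom (R3), for the identity twist.\<close>
definition jac :: "'b \<Rightarrow> 'b \<Rightarrow> 'b" where
  "jac x y = (\<Sum>j\<le>p - 2. inverse (of_nat (Suc j)) *s adcoef x y x (p - 1) j)"

text \<open>The coefficient of \<open>k^(p-1)\<close> is \<open>ad_pow x (p - 1) x = 0\<close>. The
  sum thus stops at \<open>p - 2\<close>, where every divisor \<open>Suc j\<close> occurring in
  \<open>jac\<close> is invertible.\<close>

lemma ad_pow_pred_expand: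
  "ad_pow (k *s x + y) (p - 1) x = (\<Sum>j\<le>p - 2. (k ^ j) *s adcoef x y x (p - 1) j)"
proof -
  have "adcoef x y x (p - 1) (p - 1) = 0"
    using p_gt_2 by (simp add: adcoef_top ad_pow_self)
  then show ?thesis unfolding ad_pow_expand p_eq(2) by simp
qed

lemma sum_from_1: "(\<Sum>i = 1..p - 1. g i) = (\<Sum>i\<le>p - 2. g (Suc i))"
  unfolding p_eq(2)
  by (simp only: One_nat_def sum.atLeast_Suc_atMost_Suc_shift atLeast0AtMost o_def)

lemma jac_eqI:
  assumes "\<And>k. ad_pow (k *s x + y) (p - 1) x = (\<Sum>i = 1..p - 1. (of_nat i * k ^ (i - 1)) *s s i)"
  shows "jac x y = (\<Sum>i = 1..p - 1. s i)"
proof -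
  have "(\<Sum>j\<le>p - 2. (k ^ j) *s adcoef x y x (p - 1) j) =
      (\<Sum>j\<le>p - 2. (k ^ j) *s of_nat (Suc j) *s s (Suc j))" for k
    using assms[of k] unfolding ad_pow_pred_expand sum_from_1 by (simp add: mult.commute del: of_nat_Suc)
  then have *: "adcoef x y x (p - 1) j = of_nat (Suc j) *s s (Suc j)" if "j \<le> p - 2" for j
    using that by (rule coeffs_eq[where c="adcoef x y x (p - 1)" and d="\<lambda>j. of_nat (Suc j) *s s (Suc j)"])
  show ?thesis unfolding jac_def sum_from_1
  proof (intro sum.cong refl)
    fix j assume j: "j \<in> {..p - 2}"
    then have "(of_nat (Suc j) :: 'a) \<noteq> 0" using p_gt_2 by (intro of_nat_neq_0) auto
    then show "inverse (of_nat (Suc j)) *s adcoef x y x (p - 1) j = s (Suc j)"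
      using j * by (simp del: of_nat_Suc)
  qed
qed

lemma ex_jac_coeffs:
  "\<exists>s. \<forall>k. ad_pow (k *s x + y) (p - 1) x = (\<Sum>i = 1..p - 1. (of_nat i * k ^ (i - 1)) *s s i)"
proof (intro exI allI)
  fix k
  show "ad_pow (k *s x + y) (p - 1) x = (\<Sum>i = 1..p - 1. (of_nat i * k ^ (i - 1)) *s
      inverse (of_nat i) *s adcoef x y x (p - 1) (i - 1))"
    unfolding ad_pow_pred_expand sum_from_1
  proof (intro sum.cong refl)
    fix j assume j: "j \<in> {..p - 2}"
    then have "(of_nat (Suc j) :: 'a) \<noteq> 0" using p_gt_2 by (intro of_nat_neq_0) auto
    then show "(k ^ j) *s adcoef x y x (p - 1) j = (of_nat (Suc j) * k ^ (Suc j - 1)) *s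
        inverse (of_nat (Suc j)) *s adcoef x y x (p - 1) (Suc j - 1)"
      by (simp del: of_nat_Suc)
  qed
qed

lemma jac_scale: "jac (c *s x) (c *s y) = (c ^ p) *s jac x y"
proof -
  have "c ^ (p - 1) * c = c ^ p" using p_gt_2 by (simp flip: power_Suc2)
  then show ?thesis by (simp add: jac_def adcoef_scale scale_sum_right mult.commute)
qed

text \<open>Already the innermost bracket of \<open>k *s x + y\<close> with \<open>x\<close>
  vanishes.\<close>

lemma jac_commuting:
  assumes "br y x = 0"
  shows "jac x y = 0"
proof -
  have "adcoef x y x (Suc n) j = 0" for n j
  proof (induction n arbitrary: j)
    case 0
    show ?case by (simp add: assms br_self)
  next
    case (Suc n)
    show ?case by (subst adcoef.simps) (simp only: Suc.IH br_0_right if_cancel add_0)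
  qed
  then show ?thesis unfolding jac_def p_eq(2) by (simp only: scale_zero_right sum.neutral_const)
qed

lemma jac_0_left: "jac 0 y = 0"
  by (simp add: jac_commuting)

text \<open>Differentiation under the integral. By closedness the \<open>t\<close>-derivative of
  \<open>ad_pow (k *s w t + z t) (p - 1) (w t)\<close> is the \<open>k\<close>-derivative of
  \<open>\<Gamma>\<close>. Integration over \<open>k\<close> gives
  \<open>\<Gamma> 1 - \<Gamma> 0\<close>, less the coefficient of \<open>k^p\<close>, which
  differentiation has destroyed.\<close>

lemma jac_derivative:
  assumes w: "pder a w w'" and z: "pder b z z'"
    and c: "\<And>j. j \<le> p - 2 \<Longrightarrow> pder d (\<lambda>t. adcoef (w t) (z t) (w t) (p - 1) j) (c j)"
  shows "(\<Sum>j\<le>p - 2. inverse (of_nat (Suc j)) *s c j t) =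
    ad_pow (w t + z t) (p - 1) (w' t + z' t) - ad_pow (w t) (p - 1) (w' t) - ad_pow (z t) (p - 1) (z' t)"
proof -
  define \<gamma> where "\<gamma> j = adcoef (w t) (z t) (z' t) (p - 1) j +
     (if j = 0 then 0 else adcoef (w t) (z t) (w' t) (p - 1) (j - 1))" for j
  define \<Gamma> where "\<Gamma> k = ad_pow (k *s w t + z t) (p - 1) (k *s w' t + z' t)" for k
  have \<Gamma>: "\<Gamma> k = (\<Sum>j\<le>p. (k ^ j) *s \<gamma> j)" for k
  proof -
    have p: "p = Suc (p - 1)" using p_gt_2 by simp
    have "(\<Sum>j\<le>p. (k ^ j) *s \<gamma> j) = (\<Sum>j\<le>p. (k ^ j) *s adcoef (w t) (z t) (z' t) (p - 1) j) +
        (\<Sum>j\<le>p. (k ^ j) *s (if j = 0 then 0 else adcoef (w t) (z t) (w' t) (p - 1) (j - 1)))"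
      by (simp add: \<gamma>_def scale_right_distrib sum.distrib)
    also have "(\<Sum>j\<le>p. (k ^ j) *s adcoef (w t) (z t) (z' t) (p - 1) j) =
        ad_pow (k *s w t + z t) (p - 1) (z' t)"
      unfolding ad_pow_expand by (subst (1) p) (simp add: adcoef_gt)
    also have "(\<Sum>j\<le>p. (k ^ j) *s (if j = 0 then 0 else adcoef (w t) (z t) (w' t) (p - 1) (j - 1))) =
        k *s ad_pow (k *s w t + z t) (p - 1) (w' t)"
      unfolding ad_pow_expand
      by (subst (1) p, subst sum.atMost_Suc_shift) (simp add: scale_sum_right)
    finally show ?thesis by (simp add: \<Gamma>_def ad_pow_add ad_pow_scale add.commute)
  qed
  have lessThan: "{..<p - 1} = {..p - 2}" using p_gt_2 by auto
  have k_deriv: "(\<Sum>j\<le>p - 2. (k ^ j) *s c j t) = (\<Sum>j\<le>p - 1. (k ^ j) *s of_nat (Suc j) *s \<gamma> (Suc j))" for k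
  proof -
    let ?W = "\<lambda>t. k *s w t + z t" and ?W' = "\<lambda>t. k *s w' t + z' t"
    have W: "pder (max a b) ?W ?W'"
      by (intro pder.add pder_mono[OF pder_scale[OF w]] pder_mono[OF z]) auto
    have "(\<Sum>j\<le>p - 2. (k ^ j) *s c j t) =
        (\<Sum>i<p - 1. ad_pow (?W t) i (br (?W' t) (ad_pow (?W t) (p - 1 - 1 - i) (w t)))) +
        ad_pow (?W t) (p - 1) (w' t)"
    proof (rule pder_unique)
      show "pder d (\<lambda>t. ad_pow (?W t) (p - 1) (w t)) (\<lambda>t. \<Sum>j\<le>p - 2. (k ^ j) *s c j t)"
        unfolding ad_pow_pred_expand by (intro pder_sum pder_scale c) auto
    qed (rule pder_ad_pow[OF W w])
    \<comment> \<open>Closedness exchanges the directions \<open>?W' t\<close> and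
      \<open>w t\<close>. Since \<open>w t\<close> is the \<open>k\<close>-derivative of
      \<open>?W t\<close>, the result is the derivative of \<open>\<Gamma>\<close>.\<close>
    also have "\<dots> = (\<Sum>i<p - 1. ad_pow (?W t) i (br (w t) (ad_pow (?W t) (p - 1 - 1 - i) (?W' t)))) +
        ad_pow (?W t) (p - 1) (w' t)"
      using sum_ad_pow_br_commute[of "?W t" "?W' t" "w t"]
      by (simp only: lessThan diff_diff_left one_add_one)
    also have "\<dots> = (\<Sum>j\<le>p. (of_nat j * k ^ (j - 1)) *s \<gamma> j)"
    proof (rule pder_unique[of _ \<Gamma>])
      show "pder p \<Gamma> (\<lambda>k. \<Sum>j\<le>p. (of_nat j * k ^ (j - 1)) *s \<gamma> j)"
        unfolding \<Gamma>[abs_def] by (intro pder_sum pder_mono[OF pder_monom]) auto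
    qed (unfold \<Gamma>_def, rule pder_ad_pow[OF pder_affine pder_affine])
    also have "\<dots> = (\<Sum>j\<le>p - 1. (k ^ j) *s of_nat (Suc j) *s \<gamma> (Suc j))"
    proof -
      have p: "p = Suc (p - 1)" using p_gt_2 by simp
      show ?thesis
        by (subst (1) p, subst sum.atMost_Suc_shift) (simp add: mult.commute del: of_nat_Suc)
    qed
    finally show ?thesis .
  qed
  \<comment> \<open>The term of degree \<open>p - 1\<close> carries the factor \<open>p\<close>, so
    both sides end at \<open>p - 2\<close> and coefficients can be compared.\<close>
  have p0: "(of_nat (Suc (p - 1)) :: 'a) = 0" using char p_gt_2 by (simp add: of_nat_eq_0_iff_char_dvd)
  have "(\<Sum>j\<le>p - 2. (k ^ j) *s c j t) = (\<Sum>j\<le>p - 2. (k ^ j) *s of_nat (Suc j) *s \<gamma> (Suc j))" for k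
    using k_deriv[of k] p0 unfolding p_eq(2) by (simp del: of_nat_Suc)
  then have cj: "c j t = of_nat (Suc j) *s \<gamma> (Suc j)" if "j \<le> p - 2" for j
    using that by (rule coeffs_eq[where c="\<lambda>j. c j t" and d="\<lambda>j. of_nat (Suc j) *s \<gamma> (Suc j)"])
  have "(\<Sum>j\<le>p - 2. inverse (of_nat (Suc j)) *s c j t) = (\<Sum>j\<le>p - 2. \<gamma> (Suc j))"
  proof (intro sum.cong refl)
    fix j assume j: "j \<in> {..p - 2}"
    then have "(of_nat (Suc j) :: 'a) \<noteq> 0" using p_gt_2 by (intro of_nat_neq_0) auto
    then show "inverse (of_nat (Suc j)) *s c j t = \<gamma> (Suc j)"
      using j cj by (simp del: of_nat_Suc)
  qed
  \<comment> \<open>All \<open>\<gamma> j\<close> together give \<open>\<Gamma> 1\<close>; the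
    indices 0 and \<open>p\<close> are the two missing ones.\<close>
  also have "\<dots> = \<Gamma> 1 - \<gamma> p - \<gamma> 0"
  proof -
    have "\<Gamma> 1 = (\<Sum>j\<le>Suc (Suc (p - 2)). \<gamma> j)" unfolding \<Gamma> p_eq(1)[symmetric] by simp
    also have "\<dots> = (\<gamma> 0 + (\<Sum>j\<le>p - 2. \<gamma> (Suc j))) + \<gamma> p"
      unfolding sum_split_ends unfolding p_eq(1)[symmetric] ..
    finally show ?thesis by simp
  qed
  also have "\<gamma> 0 = ad_pow (z t) (p - 1) (z' t)" by (simp add: \<gamma>_def adcoef_0)
  also have "\<gamma> p = ad_pow (w t) (p - 1) (w' t)"
    using p_gt_2 by (simp add: \<gamma>_def adcoef_gt adcoef_top)
  finally show ?thesis by (simp add: \<Gamma>_def)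
qed

section \<open>Cocycle identities and Jacobson's formula\<close>

lemma pder_jac_left:
  "pder (p - 1) (\<lambda>t. jac (t *s x + y) z)
     (\<lambda>t. ad_pow (t *s x + y + z) (p - 1) x - ad_pow (t *s x + y) (p - 1) x)"
proof -
  have "\<exists>c'. pder (p - 1) (\<lambda>t. adcoef (t *s x + y) z (t *s x + y) (p - 1) j) c'" if "j \<le> p - 2" for j
  proof -
    \<comment> \<open>This keeps the degree below \<open>p\<close>, as
      \<open>pder_zero_imp_const\<close> requires.\<close>
    have "1 + j \<le> p - 1" using that p_gt_2 by simp
    moreover obtain c' where "pder (1 + j) (\<lambda>t. adcoef (t *s x + y) z (t *s x + y) (p - 1) j) c'"
      using pder_adcoef_left[OF pder_affine pder_affine] by blast
    ultimately show ?thesis by (intro exI[of _ c']) (rule pder_mono)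
  qed
  then have "\<forall>j\<in>{..p - 2}. \<exists>c'. pder (p - 1) (\<lambda>t. adcoef (t *s x + y) z (t *s x + y) (p - 1) j) c'"
    by blast
  from bchoice[OF this] obtain c where c: "\<And>j. j \<le> p - 2 \<Longrightarrow>
      pder (p - 1) (\<lambda>t. adcoef (t *s x + y) z (t *s x + y) (p - 1) j) (c j)" by blast
  have "pder (p - 1) (\<lambda>t. jac (t *s x + y) z) (\<lambda>t. \<Sum>j\<le>p - 2. inverse (of_nat (Suc j)) *s c j t)"
    unfolding jac_def by (intro pder_sum pder_scale c) auto
  then show ?thesis
    by (rule pder_eqI)
       (simp_all add: jac_derivative[OF pder_affine pder.const c] del: of_nat_Suc)
qed

lemma pder_jac_right:
  "pder (p - 1) (\<lambda>t. jac y (t *s x + z))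
     (\<lambda>t. ad_pow (y + (t *s x + z)) (p - 1) x - ad_pow (t *s x + z) (p - 1) x)"
proof -
  have "\<forall>j. \<exists>c'. pder (p - 1) (\<lambda>t. adcoef y (t *s x + z) y (p - 1) j) c'"
  proof
    fix j
    obtain c' where "pder (p - 1 - j) (\<lambda>t. adcoef y (t *s x + z) y (p - 1) j) c'"
      using pder_adcoef_right[OF pder_affine] by blast
    from pder_mono[OF this diff_le_self]
    show "\<exists>c'. pder (p - 1) (\<lambda>t. adcoef y (t *s x + z) y (p - 1) j) c'" by blast
  qed
  from choice[OF this] obtain c
    where c: "\<And>j. pder (p - 1) (\<lambda>t. adcoef y (t *s x + z) y (p - 1) j) (c j)" by blast
  have "pder (p - 1) (\<lambda>t. jac y (t *s x + z)) (\<lambda>t. \<Sum>j\<le>p - 2. inverse (of_nat (Suc j)) *s c j t)"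
    unfolding jac_def by (intro pder_sum pder_scale c)
  then show ?thesis
    by (rule pder_eqI)
       (simp_all add: jac_derivative[OF pder.const pder_affine c] del: of_nat_Suc)
qed

lemma pder_pred_zero_imp_const: "pder (p - 1) f (\<lambda>_. 0) \<Longrightarrow> f k = f 0"
  using pder_zero_imp_const[of "p - 1" f k] char p_gt_2 by simp

text \<open>With \<open>t *s x\<close> in place of \<open>x\<close>, both sides have the same
  derivative in \<open>t\<close>, have degree below \<open>p\<close> and agree at
  \<open>t = 0\<close>. The added 0 fits the form of \<open>pder_jac_left\<close>.\<close>

lemma jac_cocycle: "jac x (y + z) + jac y z = jac y (x + z) + jac x z"
proof -
  let ?f = "\<lambda>t. jac (t *s x + 0) (y + z) + jac y z - (jac y (t *s x + z) + jac (t *s x + 0) z)"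
  have "pder (p - 1) ?f (\<lambda>_. 0)"
    by (rule pder_eqI[OF pder_diff[OF pder.add[OF pder_jac_left[of x 0 "y + z"] pder.const[of _ "jac y z"]]
          pder.add[OF pder_jac_right[of y x z] pder_jac_left[of x 0 z]]]])
       (simp_all add: algebra_simps)
  from pder_pred_zero_imp_const[OF this, of 1] show ?thesis
    by (simp add: jac_0_left)
qed

text \<open>The same deformation, now of \<open>x1\<close>; at \<open>t = 0\<close> the claim is
  \<open>jac_cocycle\<close>. It compares the two ways of pairing four summands, as (R3) on a direct
  sum requires.\<close>

lemma jac_four_term:
  "jac (x1 + x2) (x3 + x4) + jac x1 x2 + jac x3 x4 = jac (x1 + x3) (x2 + x4) + jac x1 x3 + jac x2 x4"
proof -
  let ?f = "\<lambda>t. (jac (t *s x1 + x2) (x3 + x4) + jac (t *s x1 + 0) x2 + jac x3 x4) -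
     (jac (t *s x1 + x3) (x2 + x4) + jac (t *s x1 + 0) x3 + jac x2 x4)"
  have "pder (p - 1) ?f (\<lambda>_. 0)"
    by (rule pder_eqI[OF pder_diff[OF
          pder.add[OF pder.add[OF pder_jac_left[of x1 x2 "x3 + x4"] pder_jac_left[of x1 0 x2]]
            pder.const[of _ "jac x3 x4"]]
          pder.add[OF pder.add[OF pder_jac_left[of x1 x3 "x2 + x4"] pder_jac_left[of x1 0 x3]]
            pder.const[of _ "jac x2 x4"]]]])
       (simp_all add: algebra_simps)
  from pder_pred_zero_imp_const[OF this, of 1] have "?f 1 = ?f 0" .
  also have "\<dots> = 0" using jac_cocycle[of x2 x3 x4] by (simp add: jac_0_left)
  finally show ?thesis by simp
qed

text \<open>Jacobson's formula. Along \<open>k *s x + y\<close> the terms of degree 1 to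
  \<open>p - 1\<close> form \<open>?g\<close>. The term of degree \<open>p\<close> has derivative 0,
  so \<open>?g\<close> has derivative \<open>br (ad_pow (k *s x + y) (p - 1) x) v\<close>. The
  function \<open>br (jac (k *s x) y) v\<close> has the same derivative, and both vanish at
  \<open>k = 0\<close>.\<close>

lemma ad_pow_p_add: "ad_pow (x + y) p v = ad_pow x p v + ad_pow y p v + br (jac x y) v"
proof -
  let ?g = "\<lambda>k. \<Sum>j\<le>p - 2. (k ^ Suc j) *s adcoef x y v p (Suc j)"
  have g: "ad_pow (k *s x + y) p v = ad_pow y p v + (k ^ p) *s ad_pow x p v + ?g k" for k
  proof -
    have "ad_pow (k *s x + y) p v = (\<Sum>j\<le>Suc (Suc (p - 2)). (k ^ j) *s adcoef x y v p j)"
      unfolding ad_pow_expand p_eq(1)[symmetric] ..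
    also have "\<dots> = ((k ^ 0) *s adcoef x y v p 0 + ?g k) + (k ^ p) *s adcoef x y v p p"
      unfolding sum_split_ends unfolding p_eq(1)[symmetric] ..
    finally show ?thesis by (simp add: adcoef_0 adcoef_top)
  qed
  define g' where "g' k = (\<Sum>j\<le>p - 2. (of_nat (Suc j) * k ^ j) *s adcoef x y v p (Suc j))" for k
  have pder_g: "pder (p - 1) ?g g'"
    unfolding g'_def
  proof (rule pder_sum)
    fix j assume "j \<in> {..p - 2}"
    then have "Suc j \<le> p - 1" using p_gt_2 by auto
    then show "pder (p - 1) (\<lambda>k. (k ^ Suc j) *s adcoef x y v p (Suc j))
        (\<lambda>k. (of_nat (Suc j) * k ^ j) *s adcoef x y v p (Suc j))"
      using pder_mono[OF pder_monom[of "Suc j"]] by (simp del: of_nat_Suc power_Suc)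
  qed
  have p0: "(of_nat p :: 'a) = 0" using char by (simp add: of_nat_eq_0_iff_char_dvd)
  have "pder p (\<lambda>k. ad_pow y p v + (k ^ p) *s ad_pow x p v + ?g k) (\<lambda>k. 0 + (of_nat p * k ^ (p - 1)) *s ad_pow x p v + g' k)"
    by (intro pder.add pder.const pder_monom pder_mono[OF pder_g]) simp
  then have 1: "pder p (\<lambda>k. ad_pow (k *s x + y) p v) g'"
    by (rule pder_eqI) (simp_all add: g p0)
  have atMost: "{..<p} = {..p - 1}" using p_gt_2 by auto
  have g'_eq: "g' k = br (ad_pow (k *s x + y) (p - 1) x) v" for k
    using pder_unique[OF 1 pder_ad_pow[OF pder_affine pder.const[of 0]], of k]
    by (simp only: atMost sum_ad_pow_br_pred ad_pow_0 add_0_right)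
  have "pder (p - 1) (\<lambda>k. br (jac (k *s x + 0) y) v) (\<lambda>k. br (ad_pow (k *s x + y) (p - 1) x) v)"
  proof (rule pder_eqI[OF pder_minus[OF pder_br_const[OF pder_jac_left]]])
    fix k
    have "ad_pow (k *s x) (p - 1) x = 0"
      using p_gt_2 by (simp add: ad_pow_scale_left ad_pow_self)
    then show "- br v (ad_pow (k *s x + 0 + y) (p - 1) x - ad_pow (k *s x + 0) (p - 1) x) =
        br (ad_pow (k *s x + y) (p - 1) x) v"
      by (simp add: br_skew[of v])
  qed (rule br_skew[symmetric])
  from pder_diff[OF pder_g this]
  have "pder (p - 1) (\<lambda>k. ?g k - br (jac (k *s x + 0) y) v) (\<lambda>_. 0)"
    by (simp add: g'_eq)
  from pder_pred_zero_imp_const[OF this, of 1] have "?g 1 = br (jac x y) v"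
    by (simp add: jac_0_left)
  with g[of 1] show ?thesis by (simp add: algebra_simps)
qed

end

section \<open>Untwisting Hom-Lie algebras\<close>

lemma linearD:
  assumes "Vector_Spaces.linear s1 s2 f"
  shows "f (x + y) = f x + f y" "f (s1 c x) = s2 c (f x)" "f 0 = 0" "f (- x) = - f x"
    "f (x - y) = f x - f y"
proof -
  interpret Vector_Spaces.linear s1 s2 f by fact
  show "f (x + y) = f x + f y" "f (s1 c x) = s2 c (f x)" "f 0 = 0" "f (- x) = - f x"
    "f (x - y) = f x - f y"
    by (simp_all add: add scale zero neg diff)
qed

lemma hom_lie_algD:
  assumes "hom_lie_alg sc br al"
  shows "vector_space sc"
    and "br (x + y) z = br x z + br y z" "br x (y + z) = br x y + br x z"
    and "br (sc c x) y = sc c (br x y)" "br x (sc c y) = sc c (br x y)"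
    and "br (- x) y = - br x y" "br x (- y) = - br x y"
    and "br (x - y) z = br x z - br y z" "br x (y - z) = br x y - br x z"
    and "br 0 y = 0" "br x 0 = 0"
    and "al (x + y) = al x + al y" "al (sc c x) = sc c (al x)" "al (- x) = - al x"
    and "al (x - y) = al x - al y" "al 0 = 0"
    and "br x y = - br y x"
    and "br (al x) (br y z) + br (al y) (br z x) + br (al z) (br x y) = 0"
    and "al (br x y) = br (al x) (al y)"
proof -
  from assms have l: "\<And>x. Vector_Spaces.linear sc sc (br x)"
    "\<And>y. Vector_Spaces.linear sc sc (\<lambda>x. br x y)" "Vector_Spaces.linear sc sc al"
    unfolding hom_lie_alg_def by blast+
  note linearD[OF l(1), simp] linearD[OF l(2), simp] linearD[OF l(3), simp]
  show "br (x + y) z = br x z + br y z" "br x (y + z) = br x y + br x z"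
    "br (sc c x) y = sc c (br x y)" "br x (sc c y) = sc c (br x y)"
    "br (- x) y = - br x y" "br x (- y) = - br x y"
    "br (x - y) z = br x z - br y z" "br x (y - z) = br x y - br x z"
    "br 0 y = 0" "br x 0 = 0"
    "al (x + y) = al x + al y" "al (sc c x) = sc c (al x)" "al (- x) = - al x"
    "al (x - y) = al x - al y" "al 0 = 0"
    by simp_all
  show "vector_space sc" "br x y = - br y x"
    "br (al x) (br y z) + br (al y) (br z x) + br (al z) (br x y) = 0"
    "al (br x y) = br (al x) (al y)"
    using assms unfolding hom_lie_alg_def by blast+
qed

lemma adchain_Suc_inner: "adchain br al z (Suc n) x = adchain br al (al z) n (br z x)"
  by (induction n) (simp_all add: funpow_swap1)

text \<open>\<open>ai\<close> is given as a mere inverse map; it inherits linearity and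
  multiplicativity from \<open>al\<close>.\<close>

locale modular_hom_lie_algebra =
  fixes sc :: "'a::field \<Rightarrow> 'b::ab_group_add \<Rightarrow> 'b" and br al ai and p :: nat
  assumes hom_lie: "hom_lie_alg sc br al"
    and al_ai: "al (ai x) = x" and ai_al: "ai (al x) = x"
    and infinite_scalars: "infinite (UNIV :: 'a set)"
    and char_p: "CHAR('a) = p" and p_gt: "p > 2"
begin

lemmas hom_lie_facts = hom_lie_algD[OF hom_lie]

lemmas hom_lie_simps = hom_lie_facts(2-16,19)

lemma ai_add: "ai (x + y) = ai x + ai y"
  by (metis al_ai ai_al hom_lie_facts(12))

lemma ai_scale: "ai (sc c x) = sc c (ai x)"
  by (metis al_ai ai_al hom_lie_facts(13))

lemma ai_br: "ai (br x y) = br (ai x) (ai y)"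
  by (metis al_ai ai_al hom_lie_facts(19))

lemma double_eq_0D:
  assumes "x + x = (0 :: 'b)"
  shows "x = 0"
proof -
  interpret vector_space sc by (rule hom_lie_facts(1))
  have "sc 2 x = 0" using assms scale_left_distrib[of 1 1 x] by simp
  moreover have "(2 :: 'a) \<noteq> 0"
    using of_nat_eq_0_iff_char_dvd[where 'a='a, of 2] char_p p_gt by (auto dest: dvd_imp_le)
  ultimately show ?thesis by simp
qed

text \<open>Multiplicativity turns each nested untwisted bracket into \<open>ai\<close> applied
  twice to a term of the Hom-Jacobi identity. Squares vanish by skew symmetry because 2 is
  invertible.\<close>

sublocale lie: modular_lie_algebra sc "\<lambda>x y. ai (br x y)" p
proof -
  interpret vector_space sc by (rule hom_lie_facts(1))
  show "modular_lie_algebra sc (\<lambda>x y. ai (br x y)) p"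
  proof unfold_locales
    fix x y z
    show "ai (br x x) = 0"
    proof (rule double_eq_0D)
      have "br x x + br x x = 0" using hom_lie_facts(17)[of x x] by (metis add.right_inverse)
      then show "ai (br x x) + ai (br x x) = 0"
        by (metis ai_add ai_al hom_lie_facts(16))
    qed
    have "ai (br (ai (br x y)) z) = ai (ai (br (br x y) (al z)))"
      "ai (br y (ai (br x z))) = ai (ai (br (al y) (br x z)))"
      "ai (br x (ai (br y z))) = ai (ai (br (al x) (br y z)))"
      by (simp_all add: ai_br ai_al)
    moreover have "br (al x) (br y z) = br (br x y) (al z) + br (al y) (br x z)"
      using hom_lie_facts(18)[of x y z] hom_lie_facts(17)[of "br x y" "al z"] hom_lie_facts(17)[of x z]
        hom_lie_facts(7)
      by (simp add: add_eq_0_iff)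
    ultimately show "ai (br x (ai (br y z))) = ai (br (ai (br x y)) z) + ai (br y (ai (br x z)))"
      by (simp add: ai_add)
  qed (simp_all add: ai_add ai_scale hom_lie_facts(2-5) infinite_scalars char_p p_gt)
qed

section \<open>Twisted chains in terms of the untwisted bracket\<close>

lemma al_pow_add: "(al ^^ n) (x + y) = (al ^^ n) x + (al ^^ n) y"
  by (induction n) (simp_all add: hom_lie_simps)

lemma al_pow_scale: "(al ^^ n) (sc c x) = sc c ((al ^^ n) x)"
  by (induction n) (simp_all add: hom_lie_simps)

lemma al_pow_0: "(al ^^ n) 0 = 0"
  by (induction n) (simp_all add: hom_lie_simps)

lemma al_pow_sum: "(al ^^ n) (sum f A) = (\<Sum>i\<in>A. (al ^^ n) (f i))"
  by (induction A rule: infinite_finite_induct) (simp_all add: al_pow_add al_pow_0)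

lemma al_pow_br: "(al ^^ n) (br x y) = br ((al ^^ n) x) ((al ^^ n) y)"
  by (induction n) (simp_all add: hom_lie_simps)

lemma al_pow_ai_pow: "(al ^^ n) ((ai ^^ n) x) = x"
  by (induction n arbitrary: x) (simp_all add: al_ai funpow_swap1[of ai])

lemma ai_pow_al_pow: "(ai ^^ n) ((al ^^ n) x) = x"
  by (induction n arbitrary: x) (simp_all add: ai_al funpow_swap1[of al])

text \<open>The \<open>n\<close>-th twist can be taken out of the bracket of two elements twisted
  \<open>n\<close> times, and a Hom-bracket is \<open>al\<close> of an untwisted one.\<close>

lemma adchain_untwist: "adchain br al z n y = (al ^^ n) (lie.ad_pow z n y)"
  by (induction n) (simp_all add: al_pow_br[symmetric] funpow_swap1 al_ai)

text \<open>The sum of the \<open>s_i(x,y)\<close> of (R3) for the twist \<open>al\<close>, as the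
  chain of length \<open>p - 1\<close> is the untwisted one under
  \<open>al ^^ (p - 1)\<close>.\<close>

definition hjac :: "'b \<Rightarrow> 'b \<Rightarrow> 'b" where
  "hjac x y = (al ^^ (p - 1)) (lie.jac x y)"

lemma hjac_eqI:
  assumes "\<And>k. adchain br al (sc k x + y) (p - 1) x =
    (\<Sum>i = 1..p - 1. sc (of_nat i * k ^ (i - 1)) (s i))"
  shows "hjac x y = (\<Sum>i = 1..p - 1. s i)"
proof -
  have "lie.ad_pow (sc k x + y) (p - 1) x =
      (\<Sum>i = 1..p - 1. sc (of_nat i * k ^ (i - 1)) ((ai ^^ (p - 1)) (s i)))" for k
  proof -
    have "(al ^^ (p - 1)) (lie.ad_pow (sc k x + y) (p - 1) x) =
        (al ^^ (p - 1)) (\<Sum>i = 1..p - 1. sc (of_nat i * k ^ (i - 1)) ((ai ^^ (p - 1)) (s i)))"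
      unfolding al_pow_sum al_pow_scale al_pow_ai_pow using assms[of k] by (simp add: adchain_untwist)
    from arg_cong[OF this, of "ai ^^ (p - 1)"] show ?thesis by (simp only: ai_pow_al_pow)
  qed
  from lie.jac_eqI[OF this] show ?thesis by (simp add: hjac_def al_pow_sum al_pow_ai_pow)
qed

lemma ex_hjac_coeffs:
  "\<exists>s. \<forall>k. adchain br al (sc k x + y) (p - 1) x =
    (\<Sum>i = 1..p - 1. sc (of_nat i * k ^ (i - 1)) (s i))"
proof -
  obtain s where "\<And>k. lie.ad_pow (sc k x + y) (p - 1) x =
      (\<Sum>i = 1..p - 1. sc (of_nat i * k ^ (i - 1)) (s i))"
    using lie.ex_jac_coeffs[of x y] by blast
  then show ?thesis
    by (intro exI[of _ "\<lambda>i. (al ^^ (p - 1)) (s i)"]) (simp add: adchain_untwist al_pow_sum al_pow_scale)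
qed

lemma hjac_scale: "hjac (sc c x) (sc c y) = sc (c ^ p) (hjac x y)"
  by (simp add: hjac_def lie.jac_scale al_pow_scale)

lemma hjac_commuting: "br y x = 0 \<Longrightarrow> hjac x y = 0"
  using ai_al[of 0] by (simp add: hjac_def lie.jac_commuting al_pow_0 hom_lie_simps)

lemma hjac_four_term:
  "hjac (x1 + x2) (x3 + x4) + hjac x1 x2 + hjac x3 x4 =
   hjac (x1 + x3) (x2 + x4) + hjac x1 x3 + hjac x2 x4"
  by (simp add: hjac_def lie.jac_four_term flip: al_pow_add)

text \<open>Every coefficient involved contains a bracket, and by skew symmetry the innermost one
  depends only on the adjoint maps. Central components can therefore be dropped.\<close>

lemma hjac_cong:
  assumes "br x = br x'" "br y = br y'"
  shows "hjac x y = hjac x' y'"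
proof -
  have "br y x = br y' x'" using assms hom_lie_facts(17) by metis
  moreover have "br x x = br x' x'" using assms hom_lie_facts(17) by metis
  ultimately have "lie.adcoef x y x (Suc n) j = lie.adcoef x' y' x' (Suc n) j" for n j
  proof (induction n arbitrary: j)
    case 0
    then show ?case by (simp add: hom_lie_facts(11))
  next
    case (Suc n)
    show ?case
      by (subst (1 2) lie.adcoef.simps(2)) (simp only: Suc.IH[OF Suc.prems] assms)
  qed
  then have "lie.adcoef x y x (p - 1) j = lie.adcoef x' y' x' (p - 1) j" for j
    using lie.p_eq(2) by metis
  then show ?thesis by (simp add: hjac_def lie.jac_def)
qed

text \<open>Axiom (R1) for one pair of elements, so that it can be checked on generators and then
  propagated.\<close>

definition pth_power :: "'b \<Rightarrow> 'b \<Rightarrow> bool" where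
  "pth_power x u \<longleftrightarrow> (\<forall>y. br u ((al ^^ (p - 1)) y) = adchain br al x p y)"

lemma pth_power_cong:
  assumes "pth_power x u" "br x = br x'" "br u = br u'"
  shows "pth_power x' u'"
  using assms by (simp add: pth_power_def adchain_untwist)

lemma pth_power_scale: "pth_power x u \<Longrightarrow> pth_power (sc c x) (sc (c ^ p) u)"
  unfolding pth_power_def adchain_untwist lie.ad_pow_scale_left al_pow_scale
  by (simp add: hom_lie_facts(4))

text \<open>Jacobson's formula under \<open>al ^^ p\<close>: one twist cancels \<open>ai\<close>,
  the other \<open>p - 1\<close> distribute over the bracket with \<open>jac x y\<close>.\<close>

lemma pth_power_add:
  assumes "pth_power x u" "pth_power y v"
  shows "pth_power (x + y) (u + v + hjac x y)"
proof -
  have "br (hjac x y) ((al ^^ (p - 1)) z) = (al ^^ p) (ai (br (lie.jac x y) z))" for z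
  proof -
    have "(al ^^ p) (ai (br (lie.jac x y) z)) = (al ^^ (p - 1)) (al (ai (br (lie.jac x y) z)))"
      using funpow_Suc_right[of "p - 1" al] p_gt by simp
    then show ?thesis by (simp add: hjac_def al_pow_br al_ai)
  qed
  with assms show ?thesis
    unfolding pth_power_def adchain_untwist lie.ad_pow_p_add al_pow_add
    by (simp add: hom_lie_facts(2))
qed

end

section \<open>The double extension\<close>

text \<open>Over a finite field the product of all \<open>X - a\<close>, increased by 1, has
  positive degree but no root.\<close>

lemma infinite_alg_closed_field: "infinite (UNIV :: 'a::alg_closed_field set)"
proof
  assume fin: "finite (UNIV :: 'a set)"
  define q :: "'a poly" where "q = (\<Prod>a\<in>UNIV. [:- a, 1:]) + 1"
  have deg: "degree (\<Prod>a\<in>(UNIV :: 'a set). [:- a, 1:]) = card (UNIV :: 'a set)"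
    by (subst degree_prod_eq_sum_degree) auto
  have "card (UNIV :: 'a set) > 0" using fin by (simp add: card_gt_0_iff)
  then have "degree q > 0" unfolding q_def by (subst degree_add_eq_left) (simp_all add: deg)
  then obtain z where "poly q z = 0" using alg_closed_imp_poly_has_root by blast
  moreover have "poly (\<Prod>a\<in>(UNIV :: 'a set). [:- a, 1:]) z = 0"
    using fin by (auto simp: poly_prod prod_zero_iff)
  ultimately show False by (simp add: q_def)
qed

lemma scaleL_simp [simp]: "scaleL sc c (a, x, b) = (c * a, sc c x, c * b)"
  by (simp add: scaleL_def)

lemma bracketL_simp [simp]: "bracketL sc br B D (a, x, b) (a', x', b') =
    (0, sc a (D x') - sc a' (D x) + br x x', B (D x) x')"
  by (simp add: bracketL_def)

lemma alphaL_simp [simp]: "alphaL sc al B x0 lam0 (a, x, b) = (a, sc a x0 + al x, a * lam0 + B x0 x + b)"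
  by (simp add: alphaL_def)

locale double_extension =
  fixes p :: nat
    and sc :: "'k::field \<Rightarrow> 'v::ab_group_add \<Rightarrow> 'v"
    and br :: "'v \<Rightarrow> 'v \<Rightarrow> 'v"
    and al :: "'v \<Rightarrow> 'v"
    and B :: "'v \<Rightarrow> 'v \<Rightarrow> 'k"
    and D :: "'v \<Rightarrow> 'v"
    and x0 :: 'v and lam0 :: 'k
  assumes infinite_scalars: "infinite (UNIV :: 'k set)"
    and char: "CHAR('k) = p" and p_gt: "p > 2"
    and homlie: "hom_lie_alg sc br al"
    and invol: "involutive al"
    and quad: "quadratic_form sc br al B"
    and der: "hom_derivation sc br al D"
    and B_Dinv: "\<forall>x y. B (D x) y + B x (D y) = 0"
    and x0_ad: "\<forall>y. D y + br x0 y = D y"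
    and x0_al: "al (D x0) = - D x0"
    and x0_D2: "\<forall>y. al ((D ^^ 2) y) - (D ^^ 2) (al y) = br (D x0) y"
begin

lemmas V_facts = hom_lie_algD[OF homlie]

sublocale V: vector_space sc
  by (rule V_facts(1))

lemmas br_simps = V_facts(2-16)
lemmas br_skew = V_facts(17)
lemmas br_jacobi = V_facts(18)
lemmas al_br = V_facts(19)

lemma al_al: "al (al x) = x"
  using invol by (simp add: involutive_def)

lemma B_linear: "Vector_Spaces.linear sc (*) (B x)"
  using quad by (simp add: quadratic_form_def)

lemma B_sym: "B x y = B y x"
  using quad by (simp add: quadratic_form_def)

lemma B_right: "B x (y + z) = B x y + B x z" "B x (sc c y) = c * B x y" "B x 0 = 0"
  "B x (- y) = - B x y" "B x (y - z) = B x y - B x z"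
  using linearD[OF B_linear] by blast+

lemma B_left: "B (y + z) x = B y x + B z x" "B (sc c y) x = c * B y x" "B 0 x = 0"
  "B (- y) x = - B y x" "B (y - z) x = B y x - B z x"
  using B_right by (metis B_sym)+

lemmas B_simps = B_left B_right

lemma B_inv: "B (br x y) z = B x (br y z)"
  using quad unfolding quadratic_form_def by blast

lemma B_al: "B (al x) y = B x (al y)"
  using quad unfolding quadratic_form_def by blast

lemma D_linear: "Vector_Spaces.linear sc sc D"
  using der by (simp add: hom_derivation_def)

lemmas D_simps = linearD[OF D_linear]

lemma D_al: "D (al x) = al (D x)"
  using der by (simp add: hom_derivation_def)

lemma D_br: "D (br x y) = br (D x) (al y) + br (al x) (D y)"
  using der by (simp add: hom_derivation_def)

lemma B_D: "B (D x) y = - B x (D y)"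
  using B_Dinv by (simp add: eq_neg_iff_add_eq_0)

lemma two_neq_0: "(2 :: 'k) \<noteq> 0"
  using of_nat_eq_0_iff_char_dvd[where 'a='k, of 2] char p_gt by (auto dest: dvd_imp_le)

lemma neg_self_imp_0: "(x :: 'k) = - x \<Longrightarrow> x = 0"
  using two_neq_0 by (metis add.right_inverse mult_2 mult_eq_0_iff)

lemma B_D_self: "B (D x) x = 0"
  by (rule neg_self_imp_0) (subst B_D, simp add: B_sym)

lemma odd_p: "odd p"
proof -
  have "prime p" using prime_CHAR_semidom[where 'a='k] char p_gt by simp
  then show ?thesis using p_gt by (simp add: prime_odd_nat)
qed

lemma even_pred_p: "even (p - 1)" "odd (p - 2)"
  using odd_p p_gt by auto

lemma al_pow: "(al ^^ n) x = (if even n then x else al x)"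
  by (induction n) (auto simp: al_al)

text \<open>With coefficient 1 in front of \<open>D\<close>, the condition \<open>x0_ad\<close> says
  that \<open>x0\<close> is central.\<close>

lemma br_x0: "br x0 y = 0" "br y x0 = 0"
  using x0_ad br_skew[of y x0] by auto

text \<open>\<open>D\<close> commutes with \<open>al\<close>, so the left side of
  \<open>x0_D2\<close> vanishes.\<close>

lemma br_D_x0: "br (D x0) y = 0"
  using x0_D2[rule_format, of y] by (simp add: numeral_2_eq_2 D_al)

lemma B_D_x0: "B (D x0) (al y) = - B (D x0) y"
  by (simp add: B_al[symmetric] x0_al B_simps)

section \<open>The Hom-Lie structure of the extension\<close>

abbreviation "scL \<equiv> scaleL sc"
abbreviation "brL \<equiv> bracketL sc br B D"
abbreviation "alL \<equiv> alphaL sc al B x0 lam0"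

text \<open>The inverse of the triangular map \<open>alL\<close>, solved component by component;
  \<open>al\<close> is its own inverse.\<close>

definition aiL :: "'k \<times> 'v \<times> 'k \<Rightarrow> 'k \<times> 'v \<times> 'k" where
  "aiL w = (let a = fst w; x = al (fst (snd w) - sc a x0) in (a, x, snd (snd w) - a * lam0 - B x0 x))"

lemma vector_space_L: "vector_space scL"
  by unfold_locales
     (simp_all add: scaleL_def V.scale_right_distrib V.scale_left_distrib distrib_left distrib_right)

lemma alL_aiL: "alL (aiL w) = w"
  by (cases w) (simp add: aiL_def Let_def al_al)

lemma aiL_alL: "aiL (alL w) = w"
  by (cases w) (simp add: aiL_def Let_def al_al)

text \<open>This is the \<open>e\<close> component of the Hom-Jacobi identity on \<open>V\<close>.
  Skewness of \<open>D\<close> and the derivation rule produce two terms, which invariance of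
  \<open>B\<close> and self-adjointness of \<open>al\<close> identify with the other two
  summands.\<close>

lemma B_D_br_cyclic:
  "B (D (al x)) (br y z) + B (D (al y)) (br z x) + B (D (al z)) (br x y) = 0"
proof -
  have "B (D (al x)) (br y z) = - B (al x) (br (D y) (al z)) - B (al x) (br (al y) (D z))"
    by (simp add: B_D D_br B_simps)
  also have "B (al x) (br (D y) (al z)) = B (D (al y)) (br z x)"
  proof -
    have "B (al x) (br (D y) (al z)) = B x (br (al (D y)) z)" by (simp add: B_al al_br al_al)
    also have "\<dots> = B (br (al (D y)) z) x" by (rule B_sym)
    finally show ?thesis by (simp add: B_inv D_al)
  qed
  also have "B (al x) (br (al y) (D z)) = B (D (al z)) (br x y)"
  proof -
    have "B (al x) (br (al y) (D z)) = B x (br y (al (D z)))" by (simp add: B_al al_br al_al)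
    also have "\<dots> = B (br x y) (al (D z))" by (simp add: B_inv)
    also have "\<dots> = B (D (al z)) (br x y)" by (simp add: B_sym D_al)
    finally show ?thesis .
  qed
  finally show ?thesis by simp
qed

lemma D_br_cyclic: "D (br y z) + br (al z) (D y) - br (al y) (D z) = 0"
  using br_skew[of "al z" "D y"] by (simp add: D_br)

lemma hom_lie_L: "hom_lie_alg scL brL alL"
  unfolding hom_lie_alg_def Vector_Spaces.linear_iff
proof (intro conjI allI vector_space_L)
  fix w w' w'' :: "'k \<times> 'v \<times> 'k" and c
  obtain a x b where w: "w = (a, x, b)" by (cases w)
  obtain a' x' b' where w': "w' = (a', x', b')" by (cases w')
  obtain a'' x'' b'' where w'': "w'' = (a'', x'', b'')" by (cases w'')
  note simps = w w' w'' br_simps B_simps D_simps V.scale_right_distrib V.scale_left_distrib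
    V.scale_right_diff_distrib V.scale_left_diff_distrib algebra_simps
  show "brL w (w' + w'') = brL w w' + brL w w''" by (simp add: simps)
  show "brL (w' + w'') w = brL w' w + brL w'' w" by (simp add: simps)
  show "brL w (scL c w') = scL c (brL w w')" by (simp add: simps)
  show "brL (scL c w) w' = scL c (brL w w')" by (simp add: simps)
  show "alL (w + w') = alL w + alL w'" by (simp add: simps)
  show "alL (scL c w) = scL c (alL w)" by (simp add: simps)
  show "brL w w' = - brL w' w"
    using br_skew[of x x'] B_D[of x x'] B_sym[of x "D x'"] by (simp add: w w')
  show "alL (brL w w') = brL (alL w) (alL w')"
  proof -
    have "B x0 (br x x') = 0" by (simp add: B_inv[symmetric] br_x0 B_simps)
    moreover have "B (D (al x)) (al x') = B (D x) x'" by (simp add: D_al B_al al_al)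
    \<comment> \<open>The sign from \<open>al (D x0) = - D x0\<close> cancels the one from
      \<open>D\<close>-invariance.\<close>
    moreover have "B (D x0) (al x') = B x0 (D x')" using B_D_x0[of x'] B_D[of x0 x'] by simp
    moreover have "B (D (al x)) x0 = - B x0 (D x)"
      using B_D[of x0 "al x"] B_D_x0[of x] B_sym[of x0 "D (al x)"] B_D[of x0 x] by simp
    ultimately show ?thesis by (simp add: simps br_x0 D_al al_br B_D_self)
  qed
  show "brL (alL w) (brL w' w'') + brL (alL w') (brL w'' w) + brL (alL w'') (brL w w') = 0"
  proof -
    have b0: "B (D x0) (br y z) = 0" for y z by (simp add: B_inv[symmetric] br_D_x0 B_simps)
    have s: "B (D (al y)) (D z) = B (D (al z)) (D y)" for y z
      unfolding D_al using B_al[of "D y" "D z"] B_sym[of "D y" "al (D z)"] by simp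
    have d: "D (br y z) = br (al y) (D z) - br (al z) (D y)" for y z
      using D_br_cyclic[of y z] by (simp add: algebra_simps)
    \<comment> \<open>\<open>?V\<close> and \<open>?E\<close> are the \<open>V\<close> and
      \<open>e\<close> components of one summand. In the cyclic sum all terms containing a scalar
      cancel, which leaves the Hom-Jacobi identity of \<open>V\<close> and
      \<open>B_D_br_cyclic\<close>.\<close>
    let ?V = "\<lambda>a x a' x' a'' x''. let y = sc a' (D x'') - sc a'' (D x') + br x' x''
        in sc a (D y) + br (sc a x0 + al x) y"
    let ?E = "\<lambda>a x a' x' a'' x''. let y = sc a' (D x'') - sc a'' (D x') + br x' x''
        in B (D (sc a x0 + al x)) y"
    have "?V a x a' x' a'' x'' + ?V a' x' a'' x'' a x + ?V a'' x'' a x a' x' =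
        br (al x) (br x' x'') + br (al x') (br x'' x) + br (al x'') (br x x')"
      by (simp add: Let_def br_simps D_simps V.scale_right_distrib V.scale_right_diff_distrib br_x0 d
          mult.commute algebra_simps)
    moreover have "?E a x a' x' a'' x'' + ?E a' x' a'' x'' a x + ?E a'' x'' a x a' x' =
        B (D (al x)) (br x' x'') + B (D (al x')) (br x'' x) + B (D (al x'')) (br x x')"
      using s[of x' x] s[of x'' x] s[of x'' x']
      by (simp add: Let_def B_simps D_simps b0 algebra_simps)
    ultimately show ?thesis
      using br_jacobi[of x x' x''] B_D_br_cyclic[of x x' x'']
      by (simp add: w w' w'' zero_prod_def Let_def)
  qed
qed

section \<open>Iterated twists and chains in the extension\<close>

sublocale L: modular_hom_lie_algebra scL brL alL aiL p
  by (intro modular_hom_lie_algebra.intro hom_lie_L alL_aiL aiL_alL infinite_scalars char p_gt)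

text \<open>The drift \<open>X\<close> is \<open>a\<close> times a sum of iterates of
  \<open>x0\<close> under \<open>al\<close>, hence central. As \<open>al (D x0) = - D x0\<close>,
  its image under \<open>D\<close> alternates; after an even number of twists, such as
  \<open>p - 1\<close>, brackets do not see it.\<close>

lemma alL_pow:
  "\<exists>X c. (alL ^^ n) (a, x, b) = (a, X + (al ^^ n) x, c) \<and> (\<forall>y. br X y = 0) \<and>
     D X = (if even n then 0 else sc a (D x0))"
proof (induction n)
  case 0
  show ?case by (intro exI[of _ 0] exI[of _ b]) (simp add: br_simps D_simps)
next
  case (Suc n)
  then obtain X c where X: "(alL ^^ n) (a, x, b) = (a, X + (al ^^ n) x, c)" "\<And>y. br X y = 0"
    "D X = (if even n then 0 else sc a (D x0))" by blast
  have "br (al X) y = 0" for y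
    using al_br[of X "al y"] by (simp add: al_al X(2) br_simps)
  then have "br (sc a x0 + al X) y = 0" for y
    by (simp add: br_simps br_x0)
  moreover have "D (sc a x0 + al X) = (if even (Suc n) then 0 else sc a (D x0))"
    by (simp add: D_simps D_al X(3) br_simps x0_al)
  moreover have "(alL ^^ Suc n) (a, x, b) =
      (a, sc a x0 + al X + (al ^^ Suc n) x, a * lam0 + B x0 (X + (al ^^ n) x) + c)"
    by (simp add: X(1) br_simps add.assoc)
  ultimately show ?case by blast
qed

lemma brL_alL_pow:
  "brL ((alL ^^ n) (0, u, b)) (0, w, c) = (0, br ((al ^^ n) u) w, B (D ((al ^^ n) u)) w)"
proof -
  obtain X d where "(alL ^^ n) (0, u, b) = (0, X + (al ^^ n) u, d)" "\<And>y. br X y = 0" "D X = 0"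
    using alL_pow[of n 0 u b] by auto
  then show ?thesis by (simp add: br_simps D_simps)
qed

text \<open>The innermost bracket has \<open>V\<close> component
  \<open>br u v - sc a' (D u)\<close>; on \<open>D u\<close> the remaining factors start at
  \<open>al u\<close>.\<close>

lemma ex_adchain_L_V:
  "\<exists>h. adchain brL alL (0, u, b) (Suc n) (a', v, b') =
     (0, adchain br al u (Suc n) v - sc a' (adchain br al (al u) n (D u)), h)"
proof (induction n)
  case 0
  show ?case by simp
next
  case (Suc n)
  then obtain h where h: "adchain brL alL (0, u, b) (Suc n) (a', v, b') =
      (0, adchain br al u (Suc n) v - sc a' (adchain br al (al u) n (D u)), h)" by blast
  show ?case
    by (subst adchain.simps(2)) (unfold h brL_alL_pow, simp add: br_simps funpow_swap1)
qed

text \<open>Brackets ignore \<open>e\<close> components, so the last bracket alone determines that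
  of the chain. For \<open>n = 0\<close> truncated subtraction would add a spurious term in
  \<open>a'\<close>.\<close>

lemma adchain_L_V:
  assumes "n > 0"
  shows "adchain brL alL (0, u, b) (Suc n) (a', v, b') =
     (0, adchain br al u (Suc n) v - sc a' (adchain br al (al u) n (D u)),
      B (D ((al ^^ n) u)) (adchain br al u n v - sc a' (adchain br al (al u) (n - 1) (D u))))"
proof -
  from assms obtain m where n: "n = Suc m" by (cases n) auto
  obtain h where h: "adchain brL alL (0, u, b) (Suc m) (a', v, b') =
      (0, adchain br al u (Suc m) v - sc a' (adchain br al (al u) m (D u)), h)"
    using ex_adchain_L_V by blast
  show ?thesis unfolding n
    by (subst adchain.simps(2)) (unfold h brL_alL_pow, simp add: br_simps funpow_swap1)
qed

text \<open>The \<open>e\<close> component comes from pairing \<open>D X\<close>, for the drift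
  \<open>X\<close> of \<open>e*\<close> after \<open>n\<close> twists, with the preceding value;
  \<open>D X\<close> is 0 for even \<open>n\<close>.\<close>

lemma ex_adchain_L_dual:
  "\<exists>c. adchain brL alL (1, 0, 0) (Suc n) (a', v, b') = (0, (D ^^ Suc n) v, c) \<and> (even n \<longrightarrow> c = 0)"
proof (induction n)
  case 0
  show ?case by (simp add: br_simps B_simps D_simps)
next
  case (Suc n)
  then obtain c where c: "adchain brL alL (1, 0, 0) (Suc n) (a', v, b') = (0, (D ^^ Suc n) v, c)"
    by blast
  obtain X d where X: "(alL ^^ Suc n) (1, 0, 0) = (1, X, d)" "\<And>y. br X y = 0"
    "D X = (if even (Suc n) then 0 else D x0)"
    using alL_pow[of "Suc n" 1 0 0] by (auto simp: al_pow br_simps)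
  show ?case
    by (subst adchain.simps(2)) (unfold c X(1), simp add: X(2,3) B_simps)
qed

section \<open>Adjoints of chains and axiom (R1) on \<open>V\<close> and \<open>e*\<close>\<close>

lemma B_br_skew: "B a (br z b) = - B (br z a) b"
  using B_inv[of a z b] br_skew[of a z] by (simp add: B_simps)

text \<open>Moving the brackets across \<open>B\<close> costs \<open>n\<close> signs and reverses
  their order; since \<open>al\<close> is an involution, the reversed chain is the one starting at
  \<open>(al ^^ Suc n) z\<close>.\<close>

lemma B_adchain:
  "B a (adchain br al z n b) = (- 1) ^ n * B (adchain br al ((al ^^ Suc n) z) n a) b"
proof (induction n arbitrary: a)
  case 0
  show ?case by simp
next
  case (Suc n)
  have "B a (adchain br al z (Suc n) b) = - B (br ((al ^^ n) z) a) (adchain br al z n b)"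
    by (simp add: B_br_skew)
  also have "\<dots> = (- 1) ^ Suc n * B (adchain br al ((al ^^ Suc n) z) n (br ((al ^^ n) z) a)) b"
    by (subst Suc.IH) simp
  also have "adchain br al ((al ^^ Suc n) z) n (br ((al ^^ n) z) a) =
      adchain br al ((al ^^ Suc (Suc n)) z) (Suc n) a"
    unfolding adchain_Suc_inner by (simp add: al_al)
  finally show ?case .
qed

text \<open>For the odd length \<open>p - 2\<close> the chain at \<open>al u\<close> is skew for
  \<open>B\<close>. This removes the \<open>a'\<close> term from the \<open>e\<close> component in
  \<open>adchain_L_V\<close>.\<close>

lemma B_D_adchain_D: "B (D u) (adchain br al (al u) (p - 2) (D u)) = 0"
proof (rule neg_self_imp_0)
  have "(al ^^ Suc (p - 2)) (al u) = al u" using even_pred_p by (subst al_pow) simp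
  then show "B (D u) (adchain br al (al u) (p - 2) (D u)) =
      - B (D u) (adchain br al (al u) (p - 2) (D u))"
    using B_adchain[of "D u" "al u" "p - 2" "D u"] even_pred_p B_sym two_neq_0 by auto
qed

lemma br_central_right: "(\<And>y. br X y = 0) \<Longrightarrow> br y X = 0"
  using br_skew[of y X] by simp

lemma p_eqs: "p = Suc (p - 1)" "p - 1 = Suc (p - 2)" "p - 1 > 0" "p - 2 > 0" "p - 1 - 1 = p - 2"
  using p_gt by auto

text \<open>\<open>D_u'\<close> is restrictedness of \<open>D\<close>. It accounts for the
  contribution of \<open>e*\<close> and, moved across \<open>B\<close>, for the \<open>e\<close>
  component; \<open>R1\<close> gives the rest.\<close>

lemma pth_power_V:
  assumes R1: "\<And>y. br u' ((al ^^ (p - 1)) y) = adchain br al u p y"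
    and D_u': "D u' = adchain br al (al u) (p - 1) (D u)"
  shows "L.pth_power (0, u, 0) (0, u', b)"
  unfolding L.pth_power_def
proof
  fix y :: "'k \<times> 'v \<times> 'k"
  obtain a' v b' where y: "y = (a', v, b')" by (cases y)
  obtain X c where X: "(alL ^^ (p - 1)) y = (a', X + v, c)" "\<And>y. br X y = 0" "D X = 0"
    using alL_pow[of "p - 1" a' v b'] even_pred_p by (auto simp: al_pow y)
  have R1': "br u' v = adchain br al u p v" using R1[of v] even_pred_p by (simp add: al_pow)
  have "B (D u') v = B (D u) (adchain br al u (p - 1) v)"
    using B_adchain[of "D u" u "p - 1" v] even_pred_p odd_p by (simp add: D_u' al_pow)
  moreover have "B (D u') X = 0" by (simp add: B_D X(3) B_simps)
  ultimately have "brL (0, u', b) ((alL ^^ (p - 1)) y) =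
      (0, adchain br al u p v - sc a' (adchain br al (al u) (p - 1) (D u)),
       B (D u) (adchain br al u (p - 1) v))"
    unfolding X(1) by (simp add: br_simps B_simps br_central_right[OF X(2)] R1' D_u')
  also have "\<dots> = adchain brL alL (0, u, 0) (Suc (p - 1)) (a', v, b')"
    unfolding adchain_L_V[OF p_eqs(3)] unfolding p_eqs(1)[symmetric] p_eqs(5) al_pow if_P[OF even_pred_p(1)]
    by (simp add: B_simps B_D_adchain_D)
  finally show "brL (0, u', b) ((alL ^^ (p - 1)) y) = adchain brL alL (0, u, 0) p y"
    unfolding p_eqs(1)[symmetric] by (simp only: y)
qed

text \<open>The \<open>V\<close> component is the \<open>p\<close>-property. The \<open>e\<close>
  component is 0 on both sides, by \<open>D a0 = 0\<close> and by evenness of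
  \<open>p - 1\<close>.\<close>

lemma pth_power_dual:
  assumes "p_property p sc br al D \<xi> a0"
  shows "L.pth_power (1, 0, 0) (\<xi>, a0, l)"
  unfolding L.pth_power_def
proof
  fix y :: "'k \<times> 'v \<times> 'k"
  obtain a' v b' where y: "y = (a', v, b')" by (cases y)
  have Dp: "(D ^^ p) v = sc \<xi> (D v) + br a0 v" "D a0 = 0"
    using assms even_pred_p unfolding p_property_def by (simp_all add: al_pow)
  obtain X c where X: "(alL ^^ (p - 1)) y = (a', X + v, c)" "\<And>y. br X y = 0" "D X = 0"
    using alL_pow[of "p - 1" a' v b'] even_pred_p by (auto simp: al_pow y)
  have "brL (\<xi>, a0, l) ((alL ^^ (p - 1)) y) = (0, (D ^^ p) v, 0)"
    unfolding X(1) by (simp add: X(3) br_simps B_simps D_simps br_central_right[OF X(2)] Dp)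
  also have "\<dots> = adchain brL alL (1, 0, 0) (Suc (p - 1)) y"
    using ex_adchain_L_dual[of "p - 1" a' v b'] even_pred_p p_eqs(1)[symmetric] y by auto
  finally show "brL (\<xi>, a0, l) ((alL ^^ (p - 1)) y) = adchain brL alL (1, 0, 0) p y"
    unfolding p_eqs(1)[symmetric] .
qed

lemma hjac_V:
  assumes pV: "p_structure p sc br al pV"
    and P_add: "\<forall>u v (\<eta> :: nat \<Rightarrow> 'k).
        (\<forall>k. B (D ((al ^^ (p - 2)) (sc k u + v))) (adchain br al (sc k u + v) (p - 2) u)
             = (\<Sum>i = 1..p - 1. of_nat i * \<eta> i * k ^ (i - 1)))
        \<longrightarrow> P (u + v) = P u + P v + (\<Sum>i = 1..p - 1. \<eta> i)"
  shows "(0, pV (u + v), P (u + v)) = (0, pV u, P u) + (0, pV v, P v) + L.hjac (0, u, 0) (0, v, 0)"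
proof -
  \<comment> \<open>The coefficients are chosen in \<open>L\<close>; their \<open>V\<close> and
    \<open>e\<close> components then serve as \<open>s_i\<close> in (R3) on \<open>V\<close> and as
    the scalars in \<open>P_add\<close>.\<close>
  obtain s where s: "\<And>k. adchain brL alL (scL k (0, u, 0) + (0, v, 0)) (p - 1) (0, u, 0) =
      (\<Sum>i = 1..p - 1. scL (of_nat i * k ^ (i - 1)) (s i))"
    using L.ex_hjac_coeffs[of "(0, u, 0)" "(0, v, 0)"] by blast
  define sV where "sV i = fst (snd (s i))" for i
  define \<eta> where "\<eta> i = snd (snd (s i))" for i
  have fst_sum: "fst (sum f A) = (\<Sum>i\<in>A. fst (f i))" and snd_sum: "snd (sum f A) = (\<Sum>i\<in>A. snd (f i))"
    for f :: "nat \<Rightarrow> 'x::comm_monoid_add \<times> 'y::comm_monoid_add" and A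
    by (induction A rule: infinite_finite_induct) auto
  have chain: "adchain brL alL (scL k (0, u, 0) + (0, v, 0)) (p - 1) (0, u, 0) =
      (0, adchain br al (sc k u + v) (p - 1) u,
       B (D ((al ^^ (p - 2)) (sc k u + v))) (adchain br al (sc k u + v) (p - 2) u))" for k
    using adchain_L_V[OF p_eqs(4), of "sc k u + v" 0 0 u 0] by (simp add: p_eqs(2)[symmetric])
  have V: "adchain br al (sc k u + v) (p - 1) u = (\<Sum>i = 1..p - 1. sc (of_nat i * k ^ (i - 1)) (sV i))"
    and E: "B (D ((al ^^ (p - 2)) (sc k u + v))) (adchain br al (sc k u + v) (p - 2) u) =
      (\<Sum>i = 1..p - 1. of_nat i * \<eta> i * k ^ (i - 1))" for k
    using arg_cong[OF s[of k, unfolded chain], of "fst \<circ> snd"]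
      arg_cong[OF s[of k, unfolded chain], of "snd \<circ> snd"]
    by (simp_all add: fst_sum snd_sum sV_def \<eta>_def scaleL_def mult_ac)
  have triple_sum: "(\<Sum>i\<in>A. (0, f i, g i)) = (0, sum f A, sum g A)"
    for f :: "nat \<Rightarrow> 'v" and g :: "nat \<Rightarrow> 'k" and A :: "nat set"
    by (induction A rule: infinite_finite_induct) (auto simp: zero_prod_def)
  have "L.hjac (0, u, 0) (0, v, 0) = (\<Sum>i = 1..p - 1. (0, sV i, \<eta> i))"
    by (rule L.hjac_eqI) (simp only: chain V E, simp add: triple_sum mult_ac)
  moreover have "pV (u + v) = pV u + pV v + (\<Sum>i = 1..p - 1. sV i)"
    using pV V unfolding p_structure_def by blast
  moreover have "P (u + v) = P u + P v + (\<Sum>i = 1..p - 1. \<eta> i)"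
    using P_add E by blast
  ultimately show ?thesis by (simp add: triple_sum)
qed

end

section \<open>Assembly of the \<open>p\<close>-structure on the extension\<close>

theorem theorem4p4:
  fixes p :: nat
    and sc :: "'k::alg_closed_field \<Rightarrow> 'v::ab_group_add \<Rightarrow> 'v"
    and br :: "'v \<Rightarrow> 'v \<Rightarrow> 'v"
    and al :: "'v \<Rightarrow> 'v"
    and B :: "'v \<Rightarrow> 'v \<Rightarrow> 'k"
    and pV :: "'v \<Rightarrow> 'v"
    and D :: "'v \<Rightarrow> 'v"
    and \<xi> :: 'k and a0 :: 'v
    and x0 :: 'v and lam0 :: 'k
    and l m :: 'k and u0 :: 'v
    and P :: "'v \<Rightarrow> 'k"
  assumes char: "CHAR('k) = p" and p_gt: "p > 2"
    and homlie: "hom_lie_alg sc br al"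
    and invol: "involutive al"
    and quad: "quadratic_form sc br al B"
    and pstrV: "p_structure p sc br al pV"
    and der: "hom_derivation sc br al D"
    and der_restr: "restricted_derivation p br al pV D"
    and der_pprop: "p_property p sc br al D \<xi> a0"
    and B_Dinv: "\<forall>x y. B (D x) y + B x (D y) = 0"
    and x0_ad: "\<forall>y. D y + br x0 y = D y"
    and x0_al: "al (D x0) = - D x0"
    and x0_D2: "\<forall>y. al ((D ^^ 2) y) - (D ^^ 2) (al y) = br (D x0) y"
    and u0_center: "\<forall>v. br u0 v = 0"
    and u0_D: "D u0 = 0"
    and P_hom: "\<forall>\<gamma> u. P (sc \<gamma> u) = \<gamma> ^ p * P u"
    and P_add: "\<forall>u v (\<eta> :: nat \<Rightarrow> 'k).
        (\<forall>k. B (D ((al ^^ (p - 2)) (sc k u + v))) (adchain br al (sc k u + v) (p - 2) u)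
             = (\<Sum>i = 1..p - 1. of_nat i * \<eta> i * k ^ (i - 1)))
        \<longrightarrow> P (u + v) = P u + P v + (\<Sum>i = 1..p - 1. \<eta> i)"
  shows "\<exists>f. p_structure p (scaleL sc) (bracketL sc br B D) (alphaL sc al B x0 lam0) f \<and>
             (\<forall>u. f (0, u, 0) = (0, pV u, P u)) \<and>
             f (1, 0, 0) = (\<xi>, a0, l) \<and>
             f (0, 0, 1) = (0, u0, m)"
proof -
  interpret double_extension p sc br al B D x0 lam0
    by (intro double_extension.intro infinite_alg_closed_field char p_gt homlie invol quad der
        B_Dinv x0_ad x0_al x0_D2)
  define fV where "fV v = (0 :: 'k, pV v, P v)" for v
  \<comment> \<open>The cocycle is the price of joining \<open>a e*\<close> to \<open>v\<close>;
    joining \<open>b e\<close> costs nothing, as \<open>e\<close> is central.\<close>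
  define f where "f w = (case w of (a, v, b) \<Rightarrow> scL (a ^ p) (\<xi>, a0, l) + fV v +
      scL (b ^ p) (0, u0, m) + L.hjac (a, 0, 0) (0, v, 0))" for w
  have f: "f (a, v, b) = scL (a ^ p) (\<xi>, a0, l) + fV v + scL (b ^ p) (0, u0, m) +
      L.hjac (a, 0, 0) (0, v, 0)" for a v b by (simp add: f_def)
  have pV_scale: "pV (sc c v) = sc (c ^ p) (pV v)" for c v
    using pstrV unfolding p_structure_def by blast
  have fV_scale: "fV (sc c v) = scL (c ^ p) (fV v)" for c v
    using P_hom by (simp add: fV_def pV_scale)
  have zero_pow: "(0 :: 'k) ^ p = 0" using p_gt by simp
  have fV_0: "fV 0 = 0" using fV_scale[of 0 0] zero_pow by (simp add: fV_def zero_prod_def)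
  have fV_add: "fV (u + v) = fV u + fV v + L.hjac (0, u, 0) (0, v, 0)" for u v
    unfolding fV_def by (rule hjac_V[OF pstrV P_add])
  have u0: "brL (0, sc c u0, b) w = 0" for c b w
    using u0_center by (cases w) (simp add: u0_D D_simps B_simps br_simps zero_prod_def)
  have ignore_e: "brL (a, v, b) = brL (a, v, 0)" for a v b
    by (rule ext) (simp add: bracketL_def)
  have freshman: "(a + b) ^ p = a ^ p + b ^ p" for a b :: 'k
    using prime_CHAR_semidom[where 'a='k] char p_gt by (intro freshmans_dream) simp_all
  have hjac_ignore_e: "L.hjac (a, u, b) (a', v, b') = L.hjac (a, u, 0) (a', v, 0)" for a u b a' v b'
    by (rule L.hjac_cong) (rule ignore_e)+
  have pth: "L.pth_power w (f w)" for w
  proof (cases w)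
    case (fields a v b)
    have "L.pth_power (scL a (1, 0, 0)) (scL (a ^ p) (\<xi>, a0, l))"
      by (intro L.pth_power_scale pth_power_dual der_pprop)
    moreover have "L.pth_power (0, v, 0) (fV v)"
      unfolding fV_def using pstrV der_restr
      by (intro pth_power_V) (simp_all add: p_structure_def restricted_derivation_def)
    ultimately have "L.pth_power (scL a (1, 0, 0) + (0, v, 0))
        (scL (a ^ p) (\<xi>, a0, l) + fV v + L.hjac (scL a (1, 0, 0)) (0, v, 0))"
      by (rule L.pth_power_add)
    \<comment> \<open>The \<open>e\<close> component of \<open>w\<close> and the multiple of
      \<open>(0, u0, m)\<close> in \<open>f w\<close> have zero adjoint map, so they can be inserted
      afterwards.\<close>
    then show ?thesis
    proof (rule L.pth_power_cong)
      show "brL (scL a (1, 0, 0) + (0, v, 0)) = brL w"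
        using ignore_e[of a v b] fields by simp
      show "brL (scL (a ^ p) (\<xi>, a0, l) + fV v + L.hjac (scL a (1, 0, 0)) (0, v, 0)) = brL (f w)"
      proof
        fix y
        show "brL (scL (a ^ p) (\<xi>, a0, l) + fV v + L.hjac (scL a (1, 0, 0)) (0, v, 0)) y = brL (f w) y"
          using u0[of "b ^ p" "b ^ p * m" y] by (simp add: fields f L.hom_lie_facts(2) del: bracketL_simp)
      qed
    qed
  qed
  have "p_structure p scL brL alL f"
    unfolding p_structure_def
  proof (intro conjI allI impI)
    fix x y
    show "brL (f x) ((alL ^^ (p - 1)) y) = adchain brL alL x p y"
      using pth[of x] unfolding L.pth_power_def by blast
  next
    fix k x
    show "f (scL k x) = scL (k ^ p) (f x)"
    proof (cases x)
      case (fields a v b)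
      have "L.hjac (k * a, 0, 0) (0, sc k v, 0) = scL (k ^ p) (L.hjac (a, 0, 0) (0, v, 0))"
        using L.hjac_scale[of k "(a, 0, 0)" "(0, v, 0)"] by simp
      then show ?thesis
        unfolding fields unfolding scaleL_simp
        unfolding f fV_scale power_mult_distrib L.lie.scale_right_distrib L.lie.scale_scale by simp
    qed
  next
    fix x y and s :: "nat \<Rightarrow> 'k \<times> 'v \<times> 'k"
    assume "\<forall>k. adchain brL alL (scL k x + y) (p - 1) x =
        (\<Sum>i = 1..p - 1. scL (of_nat i * k ^ (i - 1)) (s i))"
    then have s: "(\<Sum>i = 1..p - 1. s i) = L.hjac x y" by (simp add: L.hjac_eqI)
    obtain a u b where x: "x = (a, u, b)" by (cases x)
    obtain a' v b' where y: "y = (a', v, b')" by (cases y)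
    have "L.hjac (a, 0, 0) (a', 0, 0) = 0"
      by (rule L.hjac_commuting) (simp add: D_simps B_simps br_simps zero_prod_def)
    \<comment> \<open>Regrouping by \<open>e*\<close> parts and \<open>V\<close> parts reduces (R3)
      to additivity of the \<open>p\<close>-th power on scalars and to
      \<open>fV_add\<close>.\<close>
    then have "L.hjac x y + L.hjac (a, 0, 0) (0, u, 0) + L.hjac (a', 0, 0) (0, v, 0) =
        L.hjac (a + a', 0, 0) (0, u + v, 0) + L.hjac (0, u, 0) (0, v, 0)"
      using L.hjac_four_term[of "(a, 0, 0)" "(0, u, 0)" "(a', 0, 0)" "(0, v, 0)"]
      by (simp add: x y hjac_ignore_e[of a u b])
    moreover have "scL ((a + a') ^ p) w = scL (a ^ p) w + scL (a' ^ p) w" for a a' w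
      unfolding freshman by (rule L.lie.scale_left_distrib)
    ultimately show "f (x + y) = f x + f y + (\<Sum>i = 1..p - 1. s i)"
      unfolding s by (simp add: x y f fV_add algebra_simps del: scaleL_simp)
  qed
  \<comment> \<open>On \<open>V\<close>, \<open>e*\<close> and \<open>e\<close> one argument of the
    cocycle is 0, so \<open>f\<close> takes the prescribed values there.\<close>
  moreover have hjac_0: "L.hjac (0, 0, 0) w = 0" "L.hjac w (0, 0, 0) = 0" for w
    using L.hjac_commuting[of w 0] L.hjac_commuting[of 0 w] L.hom_lie_facts(10,11)
    by (simp_all only: zero_prod_def)
  have "f (0, u, 0) = (0, pV u, P u)" "f (1, 0, 0) = (\<xi>, a0, l)" "f (0, 0, 1) = (0, u0, m)" for u
    by (simp_all add: f fV_0 zero_pow hjac_0) (simp add: fV_def)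
  ultimately show ?thesis by blast
qed

end
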